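(* Let $Y$ be the process on the Polish space $E$ killed at rate $\kappa$, with killing time $\tau_\partial$, killed laws $\mathbb{P}_x$ and resolvent $\mathcal{R}$ as defined in the context, and assume $\mathbb{P}_x(\tau_\partial<\infty)=1$ for every $x\in E$. Let $\mu$ be a probability measure on $E$, let $\mathbb{P}_\mu=\int_E\mu(dx)\,\mathbb{P}_x$, and suppose that $\mu\mathcal{R}1=\mathbb{E}_\mu[\tau_\partial]<\infty$, so that the probability distribution $\Pi(\mu)=\mu\mathcal{R}(\cdot)/\mu\mathcal{R}1$ on $E$ exists. Then for every measurable $A\subset E$, $$\mathbb{P}_\mu\left(Y_{\tau_\partial}\in A\right)=\frac{\int_A\kappa(x)\,\Pi(\mu)(dx)}{\int_E\kappa(x)\,\Pi(\mu)(dx)}.$$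
   Context: Setting. $E$ is a Polish space. $\tilde Y=(\tilde\Omega,\tilde{\mathcal F},\tilde{\mathcal F}_t,\tilde Y_t,\tilde\theta_t,\tilde{\mathbb P}_x)$ is a continuous-time càdlàg right process on $E$ in the sense of Sharpe's "General Theory of Markov Processes" (in particular a strong Markov process with right-continuous paths and $\tilde{\mathbb P}_x(\tilde Y_0=x)=1$), with infinite lifetime (unkilled), realised canonically: $\tilde\Omega$ is the space of càdlàg paths $[0,\infty)\to E$ with the cylinder $\sigma$-algebra and the usual shifts. $\kappa:E\to[0,\infty)$ is a locally bounded measurable function (the killing rate). Augmented space. Let $\mathcal X=\{0,\partial\}\times E$. Let $\Omega$ be the space of càdlàg paths $\omega:[0,\infty)\to\mathcal X$ for which $\{\partial\}\times E$ is a trap: with coordinate process $Z_t(\omega)=\omega(t)=(e_t,Y_t)$, $e_t\in\{0,\partial\}$, $Y_t\in E$, and $$\tau_\partial(\omega)=\inf\{t\ge 0: Z_t(\omega)\in\{\partial\}\times E\},$$ one has $\omega(s)=\omega(\tau_\partial)$ for all $s\ge\tau_\partial(\omega)$. $\Omega$ carries the cylinder $\sigma$-algebra. Thus $Y_{\tau_\partial}$ is the location at which the process is killed. Killing operators. For $t\ge0$ define $k_t:\Omega\to\Omega$ as follows, for $\omega=(e,\tilde\omega)$. If $t<\tau_\partial(\omega)$, then $k_t(\omega)(s)=\omega(s)$ for $0\le s<t$ and $k_t(\omega)(s)=(\partial,\tilde\omega(t))$ for $s\ge t$. If $t\ge\tau_\partial(\omega)$, then $k_t(\omega)=\omega$.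 Laws. $\mathbb P^0_x$ is the image of $\tilde{\mathbb P}_x$ under the map $\psi:\tilde\Omega\to\Omega$, $\psi(\tilde\omega)(s)=(0,\tilde\omega(s))$. Let $m_t=\exp\left(-\int_0^t\kappa(Y_s)\,ds\right)$, so that $-dm_t=\kappa(Y_t)m_t\,dt$. The killed law $\mathbb P_x$ on $\Omega$ is defined, for bounded measurable $H$ on $\Omega$, by $$\mathbb P_x(H)=\mathbb P^0_x\left[\int_0^\infty H\circ k_t\,(-dm_t)\right].$$ Here points $x\in E$ are identified with $(0,x)\in\{0\}\times E$, and a law applied to a function denotes expectation. $\mathbb E_\mu$ is expectation under $\mathbb P_\mu$. Standing assumption: killing occurs in finite time almost surely from every starting point, $\mathbb P_x(\tau_\partial<\infty)=1$ for all $x\in E$; equivalently $\int_0^\infty\kappa(Y_s)\,ds=\infty$ holds $\mathbb P^0_x$-almost surely, so that there is no mass at $t=\infty$ in the formula $\mathbb P_x(H)=\mathbb P^0_x\left[\int_0^\infty H\circ k_t\,(-dm_t)\right]$ defining $\mathbb P_x$. Semigroup and resolvent. For nonnegative measurable $f$ on $E$, $P_t(x,f)=\mathbb P_x\left[f(Y_t)1_{\{\tau_\partial>t\}}\right]$ is the sub-Markovian semigroup of the killed process, and $$\mathcal R f(x)=\int_0^\infty P_t(x,f)\,dt,\qquad \mu\mathcal R f=\int_E\mu(dx)\,\mathcal R f(x).$$ The distribution $\Pi(\mu)$. When $\mu\mathcal R1=\mathbb E_\mu[\tau_\partial]<\infty$, $\Pi(\mu)$ is the probability measure on $E$ given by $\Pi(\mu)(f)=\mu\mathcal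 R f/\mu\mathcal R 1$ for nonnegative measurable $f$. (It is the invariant distribution of the $\mu$-resurrected process, i.e. the unkilled process on $E$ that evolves like $Y$ but at each killing event, occurring at rate $\kappa$, is restarted independently from a point sampled from $\mu$; only the formula for $\Pi(\mu)$ is needed for the statement.) *)

theory Defs
  imports "HOL-Probability.Probability_Measure"
begin

section \<open>Path spaces\<close>

text \<open>A path indexed by $[0,\infty)$ is a function on the reals, \<^const>\<open>undefined\<close> at negative times.\<close>

definition cadlag :: "(real \<Rightarrow> 'b::topological_space) \<Rightarrow> bool" where
  "cadlag \<omega> \<longleftrightarrow>
     (\<forall>t\<ge>0. (\<omega> \<longlongrightarrow> \<omega> t) (at_right t)) \<and>
     (\<forall>t>0. \<exists>l. (\<omega> \<longlongrightarrow> l) (at_left t))"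

definition cadlag_paths :: "(real \<Rightarrow> 'b::topological_space) set" where
  "cadlag_paths = {\<omega> \<in> extensional {0..}. cadlag \<omega>}"

text \<open>Only the space and the cylinder \<open>\<sigma>\<close>-algebra of this ``measure'' are used.\<close>

definition cylinder_space ::
    "(real \<Rightarrow> 'b::topological_space) set \<Rightarrow> (real \<Rightarrow> 'b) measure" where
  "cylinder_space \<Omega> = restrict_space (PiM {0..} (\<lambda>_. borel)) \<Omega>"

abbreviation path_space :: "(real \<Rightarrow> 'b::topological_space) measure" where
  "path_space \<equiv> cylinder_space cadlag_paths"

definition natural_filtration :: "real \<Rightarrow> (real \<Rightarrow> 'b::topological_space) set set" where
  "natural_filtration t =
     sigma_sets cadlag_paths
       {{\<omega> \<in> cadlag_paths. \<omega> s \<in> B} | s B. 0 \<le> s \<and> s \<le> t \<and> B \<in> sets borel}"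

definition shift :: "real \<Rightarrow> (real \<Rightarrow> 'b) \<Rightarrow> (real \<Rightarrow> 'b)" where
  "shift t \<omega> = restrict (\<lambda>s. \<omega> (t + s)) {0..}"


section \<open>Right processes\<close>

definition borel_prob :: "'a::topological_space measure \<Rightarrow> bool" where
  "borel_prob \<mu> \<longleftrightarrow> prob_space \<mu> \<and> sets \<mu> = sets borel"

definition universally_measurable :: "('a::topological_space \<Rightarrow> ennreal) \<Rightarrow> bool" where
  "universally_measurable f \<longleftrightarrow>
     (\<forall>\<mu>. borel_prob \<mu> \<longrightarrow> f \<in> borel_measurable (completion \<mu>))"

text \<open>The law $\int \mu(dx)\,P_x$ on the measurable space \<open>N\<close>. The maps $x \mapsto P_x(A)$ are only
  universally measurable in general, so the integral is taken for the completion of \<open>\<mu>\<close>.\<close>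

definition mixed_law ::
    "'b measure \<Rightarrow> ('a \<Rightarrow> 'b measure) \<Rightarrow> 'a measure \<Rightarrow> 'b measure" where
  "mixed_law N P \<mu> =
     measure_of (space N) (sets N) (\<lambda>A. \<integral>\<^sup>+x. emeasure (P x) A \<partial>completion \<mu>)"

definition transition ::
    "('a \<Rightarrow> (real \<Rightarrow> 'a) measure) \<Rightarrow> real \<Rightarrow> ('a \<Rightarrow> ennreal) \<Rightarrow> 'a \<Rightarrow> ennreal" where
  "transition P t f x = (\<integral>\<^sup>+\<omega>. f (\<omega> t) \<partial>completion (P x))"

definition excessive ::
    "('a::topological_space \<Rightarrow> (real \<Rightarrow> 'a) measure) \<Rightarrow> real \<Rightarrow> ('a \<Rightarrow> ennreal) \<Rightarrow> bool" where
  "excessive P \<alpha> f \<longleftrightarrow>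
     universally_measurable f \<and>
     (\<forall>x. \<forall>t\<ge>0. ennreal (exp (- \<alpha> * t)) * transition P t f x \<le> f x) \<and>
     (\<forall>x. ((\<lambda>t. ennreal (exp (- \<alpha> * t)) * transition P t f x) \<longlongrightarrow> f x) (at_right 0))"

text \<open>Sharpe's definition of a right process, for the canonical realisation on cadlag paths
  with infinite lifetime: a normal, universally measurable Markov family whose \<open>\<alpha>\<close>-excessive
  functions are almost surely right-continuous along the paths (Sharpe's hypotheses (HD1) and
  (HD2)). As in Sharpe, the strong Markov property and the right-continuity of the augmented
  filtration are consequences of these conditions.\<close>

definition cadlag_right_process ::
    "('a::polish_space \<Rightarrow> (real \<Rightarrow> 'a) measure) \<Rightarrow> bool" where
  "cadlag_right_process P \<longleftrightarrow>
     (\<forall>x. prob_space (P x) \<and> sets (P x) = sets path_space) \<and>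
     (\<forall>A\<in>sets path_space. universally_measurable (\<lambda>x. emeasure (P x) A)) \<and>
     (\<forall>x. emeasure (P x) {\<omega> \<in> cadlag_paths. \<omega> 0 = x} = 1) \<and>
     (\<forall>\<mu>. borel_prob \<mu> \<longrightarrow>
        (\<forall>t\<ge>0. \<forall>\<Lambda>\<in>natural_filtration t. \<forall>B\<in>sets path_space.
           emeasure (mixed_law path_space P \<mu>) {\<omega> \<in> \<Lambda>. shift t \<omega> \<in> B} =
           (\<integral>\<^sup>+\<omega>\<in>\<Lambda>. emeasure (P (\<omega> t)) B \<partial>completion (mixed_law path_space P \<mu>)))) \<and>
     (\<forall>\<alpha>>0. \<forall>f. excessive P \<alpha> f \<longrightarrow>
        (\<forall>\<mu>. borel_prob \<mu> \<longrightarrow>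
           (AE \<omega> in mixed_law path_space P \<mu>.
              \<forall>t\<ge>0. ((\<lambda>s. f (\<omega> s)) \<longlongrightarrow> f (\<omega> t)) (at_right t))))"

definition locally_bounded :: "('a::topological_space \<Rightarrow> real) \<Rightarrow> bool" where
  "locally_bounded \<kappa> \<longleftrightarrow> (\<forall>x. \<exists>U. open U \<and> x \<in> U \<and> (\<exists>C. \<forall>y\<in>U. \<bar>\<kappa> y\<bar> \<le> C))"


section \<open>The augmented space and the killed process\<close>

text \<open>The state space $\{0,\partial\} \times E$ is \<^typ>\<open>bool \<times> 'a\<close>, \<^const>\<open>True\<close> standing for
  $\partial$; the topology of \<^typ>\<open>bool\<close> is discrete.\<close>

definition killing_time :: "(real \<Rightarrow> bool \<times> 'a) \<Rightarrow> ennreal" where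
  "killing_time \<omega> = Inf {ennreal t | t. 0 \<le> t \<and> fst (\<omega> t)}"

text \<open>Meaningful on paths with finite killing time.\<close>

definition killing_location :: "(real \<Rightarrow> bool \<times> 'a) \<Rightarrow> 'a" where
  "killing_location \<omega> = snd (\<omega> (enn2real (killing_time \<omega>)))"

definition trapped_paths :: "(real \<Rightarrow> bool \<times> 'a::topological_space) set" where
  "trapped_paths =
     {\<omega> \<in> cadlag_paths. \<forall>s\<ge>0. killing_time \<omega> \<le> ennreal s \<longrightarrow>
        \<omega> s = \<omega> (enn2real (killing_time \<omega>))}"

abbreviation augmented_space :: "(real \<Rightarrow> bool \<times> 'a::topological_space) measure" where
  "augmented_space \<equiv> cylinder_space trapped_paths"

definition kill_at :: "real \<Rightarrow> (real \<Rightarrow> bool \<times> 'a) \<Rightarrow> (real \<Rightarrow> bool \<times> 'a)" where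
  "kill_at t \<omega> =
     (if ennreal t < killing_time \<omega>
      then restrict (\<lambda>s. if s < t then \<omega> s else (True, snd (\<omega> t))) {0..}
      else \<omega>)"

definition embed_path :: "(real \<Rightarrow> 'a) \<Rightarrow> (real \<Rightarrow> bool \<times> 'a)" where
  "embed_path \<omega> = restrict (\<lambda>s. (False, \<omega> s)) {0..}"

definition unkilled_law ::
    "('a::topological_space \<Rightarrow> (real \<Rightarrow> 'a) measure) \<Rightarrow> 'a \<Rightarrow> (real \<Rightarrow> bool \<times> 'a) measure" where
  "unkilled_law P x = distr (P x) augmented_space embed_path"

definition survival_weight :: "('a \<Rightarrow> real) \<Rightarrow> (real \<Rightarrow> bool \<times> 'a) \<Rightarrow> real \<Rightarrow> real" where
  "survival_weight \<kappa> \<omega> t = exp (- (LINT s:{0..t}|lborel. \<kappa> (snd (\<omega> s))))"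

text \<open>The Stieltjes measure $-dm_t$ is \<^const>\<open>interval_measure\<close> of $t \mapsto -m_t$. Since $m_t = 1$ for
  $t \le 0$, it gives no mass to $(-\infty,0]$. The killed law is specified through its values on
  indicators \<open>H\<close>.\<close>

definition killed_law ::
    "('a::topological_space \<Rightarrow> real) \<Rightarrow> ('a \<Rightarrow> (real \<Rightarrow> 'a) measure) \<Rightarrow> 'a
      \<Rightarrow> (real \<Rightarrow> bool \<times> 'a) measure" where
  "killed_law \<kappa> P x =
     measure_of (space augmented_space) (sets augmented_space)
       (\<lambda>A. \<integral>\<^sup>+\<omega>. (\<integral>\<^sup>+t\<in>{0..}. indicator A (kill_at t \<omega>)
                      \<partial>interval_measure (\<lambda>t. - survival_weight \<kappa> \<omega> t))
              \<partial>unkilled_law P x)"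

definition killed_law_from ::
    "('a::topological_space \<Rightarrow> real) \<Rightarrow> ('a \<Rightarrow> (real \<Rightarrow> 'a) measure) \<Rightarrow> 'a measure
      \<Rightarrow> (real \<Rightarrow> bool \<times> 'a) measure" where
  "killed_law_from \<kappa> P \<mu> = mixed_law augmented_space (killed_law \<kappa> P) \<mu>"

definition killed_semigroup ::
    "('a::topological_space \<Rightarrow> real) \<Rightarrow> ('a \<Rightarrow> (real \<Rightarrow> 'a) measure)
      \<Rightarrow> real \<Rightarrow> ('a \<Rightarrow> ennreal) \<Rightarrow> 'a \<Rightarrow> ennreal" where
  "killed_semigroup \<kappa> P t f x =
     (\<integral>\<^sup>+\<omega>. f (snd (\<omega> t)) * indicator {\<omega>. ennreal t < killing_time \<omega>} \<omega> \<partial>killed_law \<kappa> P x)"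

definition resolvent ::
    "('a::topological_space \<Rightarrow> real) \<Rightarrow> ('a \<Rightarrow> (real \<Rightarrow> 'a) measure)
      \<Rightarrow> ('a \<Rightarrow> ennreal) \<Rightarrow> 'a \<Rightarrow> ennreal" where
  "resolvent \<kappa> P f x = (\<integral>\<^sup>+t\<in>{0..}. killed_semigroup \<kappa> P t f x \<partial>lborel)"

definition resolvent_from ::
    "('a::topological_space \<Rightarrow> real) \<Rightarrow> ('a \<Rightarrow> (real \<Rightarrow> 'a) measure)
      \<Rightarrow> 'a measure \<Rightarrow> ('a \<Rightarrow> ennreal) \<Rightarrow> ennreal" where
  "resolvent_from \<kappa> P \<mu> f = (\<integral>\<^sup>+x. resolvent \<kappa> P f x \<partial>completion \<mu>)"

text \<open>The map \<open>\<Pi>\<close>, again specified on indicators.\<close>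

definition resurrection_invariant ::
    "('a::topological_space \<Rightarrow> real) \<Rightarrow> ('a \<Rightarrow> (real \<Rightarrow> 'a) measure)
      \<Rightarrow> 'a measure \<Rightarrow> 'a measure" where
  "resurrection_invariant \<kappa> P \<mu> =
     measure_of UNIV (sets borel)
       (\<lambda>A. resolvent_from \<kappa> P \<mu> (indicator A) / resolvent_from \<kappa> P \<mu> (\<lambda>_. 1))"

end

theory Submission
  imports Defs "HOL-Probability.Giry_Monad"
begin

text \<open>
  Write $m_t = \exp(-\int_0^t \kappa(Y_s)\,ds)$ for the conditional probability, given the unkilled
  path, of surviving beyond time $t$. The idea is that both sides of the claim are integrals of
  $\kappa$ against the expected time which the killed process spends at each location: killing at
  rate $\kappa$ puts mass $\kappa(y)$ times the occupation of $y$ on a killing at $y$.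

  In detail, a path is killed at a time with density $\kappa(Y_t)\,m_t$, so the killed law is the
  image of $\tilde P_x(d\omega)\,\kappa(\omega_t)\,m_t\,dt$ under $(\omega, t) \mapsto k_t\omega$
  (\<open>killed_law_eq_killing_kernel\<close>). A path killed at time $t$ has killing location
  $\omega_t$, hence
  \[ P_x(Y_{\tau_\partial} \in A) = \tilde P_x \int_0^\infty 1_A(Y_t)\,\kappa(Y_t)\,m_t\,dt. \]
  For the semigroup, integrating the density over killing times after $t$ gives $m_t - m_\infty$.
  Almost sure killing means $m_\infty = 0$, so that $P_t f(x) = \tilde P_x[f(Y_t)\,m_t]$
  (\<open>killed_semigroup_eq\<close>), and Tonelli turns the resolvent into
  \[ \mathcal R f(x) = \tilde P_x \int_0^\infty f(Y_t)\,m_t\,dt \]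
  (\<open>resolvent_eq\<close>). Comparing the two displays,
  $P_x(Y_{\tau_\partial} \in A) = \mathcal R(\kappa 1_A)(x)$
  (\<open>killing_location_distribution\<close>).

  Integrating in $\mu(dx)$ gives $P_\mu(Y_{\tau_\partial} \in A) = \int_A \kappa\,d\nu$ for the
  occupation measure $\nu = \mu\mathcal R$, and $\int \kappa\,d\nu = 1$. As $\Pi(\mu)$ is
  $\nu$ divided by the finite constant $\nu(E)$, this constant cancels in the quotient. It does not
  vanish, since otherwise $\int \kappa\,d\nu$ would.

  Two points need work beyond this computation. The rate $\kappa$ is only measurable and locally
  bounded, so $-dm_t = \kappa(Y_t)\,m_t\,dt$ cannot be obtained by differentiating $m$ at every
  time; \<open>survival_increment\<close> proves it from a quadratic error estimate. And all laws are
  defined by their values on measurable sets, so every formula rests on joint measurability in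
  $(\omega, t)$, which comes from right-continuity of paths (\<open>measurable_eval_path\<close>).
\<close>

section \<open>Integrals of bounded rates\<close>

text \<open>The derivative exists and vanishes everywhere on \<open>S\<close>. This is how two functions
  with increments equal up to second order are recognised as differing by a constant.\<close>

lemma quadratic_modulus_imp_constant:
  fixes D :: "real \<Rightarrow> real"
  assumes S: "convex S"
    and bound: "\<And>s t. s \<in> S \<Longrightarrow> t \<in> S \<Longrightarrow> s \<le> t \<Longrightarrow> \<bar>D t - D s\<bar> \<le> K * (t - s)\<^sup>2"
    and "s \<in> S" "t \<in> S"
  shows "D s = D t"
proof -
  have "(D has_field_derivative 0) (at x within S)" if x: "x \<in> S" for x
    unfolding has_field_derivative_iff
  proof (rule Lim_null_comparison)
    have "((\<lambda>y. K * \<bar>y - x\<bar>) \<longlongrightarrow> K * \<bar>x - x\<bar>) (at x within S)"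
      by (intro tendsto_intros)
    then show "((\<lambda>y. K * \<bar>y - x\<bar>) \<longlongrightarrow> 0) (at x within S)"
      by simp
    have "norm ((D y - D x) / (y - x)) \<le> K * \<bar>y - x\<bar>" if "y \<in> S" "y \<noteq> x" for y
    proof -
      have "\<bar>D y - D x\<bar> \<le> K * (y - x)\<^sup>2"
        using bound[OF x that(1)] bound[OF that(1) x]
        by (cases "x \<le> y") (auto simp: power2_commute abs_minus_commute)
      then have "\<bar>D y - D x\<bar> \<le> K * \<bar>y - x\<bar> * \<bar>y - x\<bar>"
        by (simp add: power2_eq_square abs_mult_self_eq mult.assoc)
      with that show ?thesis
        by (simp add: abs_divide divide_le_eq)
    qed
    then show "\<forall>\<^sub>F y in at x within S. norm ((D y - D x) / (y - x)) \<le> K * \<bar>y - x\<bar>"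
      by (auto simp: eventually_at_filter)
  qed
  then obtain c where "\<And>x. x \<in> S \<Longrightarrow> D x = c"
    using has_field_derivative_zero_constant[OF S] by metis
  with assms(3,4) show ?thesis by simp
qed

lemma set_integrable_bounded_interval:
  fixes g :: "real \<Rightarrow> real"
  assumes [measurable]: "g \<in> borel_measurable borel"
    and bound: "\<And>t. t \<in> {a..b} \<Longrightarrow> \<bar>g t\<bar> \<le> C"
  shows "set_integrable lborel {a..b} g"
  unfolding set_integrable_def
proof (rule Bochner_Integration.integrable_bound)
  show "integrable lborel (\<lambda>t. indicator {a..b} t *\<^sub>R C)"
    by (intro integrable_scaleR_left integrable_real_indicator) (auto simp: emeasure_lborel_Icc_eq)
  show "AE t in lborel. norm (indicator {a..b} t *\<^sub>R g t) \<le> norm (indicator {a..b} t *\<^sub>R C)"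
    using bound by (auto simp: indicator_def intro!: AE_I2 intro: order_trans[OF _ abs_ge_self])
qed measurable

lemma borel_measurable_set_integral_Icc [measurable]:
  fixes g :: "'b \<Rightarrow> real \<Rightarrow> real"
  assumes [measurable]: "(\<lambda>(x, t). g x t) \<in> borel_measurable (M \<Otimes>\<^sub>M borel)"
    and [measurable]: "b \<in> borel_measurable M"
  shows "(\<lambda>x. LINT s:{a..b x}|lborel. g x s) \<in> borel_measurable M"
proof -
  have *: "indicator {a..b x} s *\<^sub>R g x s = (if a \<le> s \<and> s \<le> b x then g x s else 0)" for x s
    by (simp add: indicator_def)
  show ?thesis
    unfolding set_lebesgue_integral_def * by measurable
qed

lemma cumulative_integral_increment:
  fixes g :: "real \<Rightarrow> real"
  defines "G \<equiv> (\<lambda>t. LINT s:{0..t}|lborel. g s)"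
  assumes [measurable]: "g \<in> borel_measurable borel" and nonneg: "\<And>t. 0 \<le> g t"
    and bounded: "\<And>t. t \<in> {0..b} \<Longrightarrow> g t \<le> C" and "0 \<le> C"
    and st: "s \<le> t" "t \<le> b"
  shows "0 \<le> G t - G s" "G t - G s \<le> C * (t - s)"
proof -
  have int: "set_integrable lborel {0..t} g"
    by (rule set_integrable_bounded_interval[where C=C])
       (use st bounded nonneg in auto)
  define I where "I = {0..t} - {0..s}"
  have I: "I \<subseteq> {s<..t}" "I \<subseteq> {0..t}" "I \<in> sets lborel"
    by (auto simp: I_def)
  \<comment> \<open>Taking \<open>I\<close> as a set difference covers negative times, where the integrals vanish.\<close>
  have "{0..t} = {0..s} \<union> I" "{0..s} \<inter> I = {}" using st by (auto simp: I_def)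
  moreover have "set_integrable lborel {0..s} g" and intI: "set_integrable lborel I g"
    by (rule set_integrable_subset[OF int]; use st I in auto)+
  ultimately have eq: "G t - G s = (LINT u:I|lborel. g u)"
    by (simp add: set_integral_Un G_def)
  show "0 \<le> G t - G s"
    unfolding eq set_lebesgue_integral_def by (intro integral_nonneg_AE) (simp add: nonneg)
  have int_const: "set_integrable lborel {s..t} (\<lambda>_. C)"
    by (rule set_integrable_bounded_interval[where C="\<bar>C\<bar>"]) auto
  have "(LINT u:I|lborel. g u) \<le> (LINT u:{s..t}|lborel. C)"
    unfolding set_lebesgue_integral_def
  proof (rule integral_mono)
    show "integrable lborel (\<lambda>u. indicator I u *\<^sub>R g u)" "integrable lborel (\<lambda>u. indicator {s..t} u *\<^sub>R C)"
      using intI int_const by (simp_all add: set_integrable_def)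
    show "indicator I u *\<^sub>R g u \<le> indicator {s..t} u *\<^sub>R C" for u
      using I(1,2) bounded[of u] st \<open>0 \<le> C\<close> by (auto simp: indicator_def dest!: subsetD)
  qed
  also have "\<dots> = C * (t - s)"
    using st by (simp add: set_integral_const measure_def)
  finally show "G t - G s \<le> C * (t - s)"
    by (simp add: eq)
qed

text \<open>The fundamental theorem of calculus for \<open>exp (- G)\<close>, where \<open>G\<close> is the integral
  of a rate \<open>g\<close> that may be discontinuous everywhere. If \<open>G\<close> grows by \<open>\<Delta>\<close>
  over an interval from \<open>s\<close> to \<open>t\<close>, then both the decrease of \<open>m = exp (- G)\<close> and the
  integral of \<open>g m\<close> lie between \<open>m t * \<Delta>\<close> and \<open>m s * \<Delta>\<close>. They differ by at
  most \<open>\<Delta>\<^sup>2\<close>, which is of second order because \<open>g\<close> is bounded.\<close>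

lemma survival_increment:
  fixes g :: "real \<Rightarrow> real"
  defines "m \<equiv> (\<lambda>t. exp (- (LINT s:{0..t}|lborel. g s)))"
  assumes g[measurable]: "g \<in> borel_measurable borel" and nonneg: "\<And>t. 0 \<le> g t"
    and bounded: "\<And>t. t \<in> {0..b} \<Longrightarrow> g t \<le> C"
    and ab: "0 \<le> a" "a \<le> b"
  shows "(\<integral>\<^sup>+t\<in>{a<..b}. ennreal (g t * m t) \<partial>lborel) = ennreal (m a - m b)"
proof -
  define G where "G = (\<lambda>t. LINT s:{0..t}|lborel. g s)"
  define H where "H = (\<lambda>t. LINT s:{0..t}|lborel. g s * m s)"
  have m: "m t = exp (- G t)" for t
    by (simp add: m_def G_def)
  have m_meas[measurable]: "m \<in> borel_measurable borel"
    unfolding m_def by measurable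
  have G_nonneg: "0 \<le> G t" for t
    unfolding G_def set_lebesgue_integral_def by (intro integral_nonneg_AE) (simp add: nonneg)
  have m_le: "0 < m t" "m t \<le> 1" for t
    using G_nonneg by (simp_all add: m)
  have C: "0 \<le> C"
    using bounded[of b] nonneg[of b] ab by simp
  have int_g: "set_integrable lborel {s..t} g" if "0 \<le> s" "t \<le> b" for s t
    by (rule set_integrable_bounded_interval[where C=C])
       (use that bounded nonneg in auto)
  have gm_le: "g t * m t \<le> C" if "t \<in> {0..b}" for t
    using mult_mono[OF bounded[OF that] m_le(2) C] m_le(1)[of t] by (simp add: less_imp_le)
  have int_gm: "set_integrable lborel {s..t} (\<lambda>t. g t * m t)" if "0 \<le> s" "t \<le> b" for s t
    by (rule set_integrable_bounded_interval[where C=C])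
       (use that gm_le nonneg m_le in \<open>auto simp: abs_mult less_imp_le\<close>)
  have Ioc: "set_integrable lborel {s<..t} f" if "set_integrable lborel {s..t} f" for s t and f :: "real \<Rightarrow> real"
    by (rule set_integrable_subset[OF that]) auto
  have split: "(LINT u:{0..t}|lborel. f u) - (LINT u:{0..s}|lborel. f u) = (LINT u:{s<..t}|lborel. f u)"
    if "set_integrable lborel {0..t} f" "0 \<le> s" "s \<le> t" for s t and f :: "real \<Rightarrow> real"
  proof -
    have "{0..t} = {0..s} \<union> {s<..t}" using that by auto
    moreover have "set_integrable lborel {0..s} f" "set_integrable lborel {s<..t} f"
      by (rule set_integrable_subset[OF that(1)]; use that in auto)+
    moreover have "{0..s} \<inter> {s<..t} = {}" by auto
    ultimately show ?thesis
      by (simp add: set_integral_Un)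
  qed
  \<comment> \<open>The loss of survival probability is compensated exactly by the accumulated killing mass \<open>H\<close>.\<close>
  have "m s + H s = m t + H t" if "s \<in> {0..b}" "t \<in> {0..b}" for s t
  proof (rule quadratic_modulus_imp_constant[of "{0..b}" "\<lambda>t. m t + H t" "C\<^sup>2"])
    fix s t assume st: "s \<in> {0..b}" "t \<in> {0..b}" "s \<le> t"
    define \<Delta> where "\<Delta> = G t - G s"
    have \<Delta>: "\<Delta> = (LINT u:{s<..t}|lborel. g u)"
      unfolding \<Delta>_def G_def by (rule split) (use st int_g in auto)
    have inc: "0 \<le> G v - G u" "G v - G u \<le> C * (v - u)" if "u \<le> v" "v \<le> b" for u v
      unfolding G_def by (rule cumulative_integral_increment[OF g nonneg bounded C]; use that in simp)+
    have \<Delta>0: "0 \<le> \<Delta>" and \<Delta>C: "\<Delta> \<le> C * (t - s)"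
      unfolding \<Delta>_def using inc[of s t] st by auto
    have m_anti: "m v \<le> m u" if "u \<le> v" "v \<le> b" for u v
      using inc(1)[OF that] by (simp add: m)
    have HD: "H t - H s = (LINT u:{s<..t}|lborel. g u * m u)"
      unfolding H_def by (rule split) (use st int_gm in auto)
    have int_st: "set_integrable lborel {s<..t} g" "set_integrable lborel {s<..t} (\<lambda>u. g u * m u)"
      using st int_g int_gm Ioc by auto
    have int_c: "set_integrable lborel {s<..t} (\<lambda>u. c * g u)"  for c :: real
      using int_st(1) by simp
    have "(LINT u:{s<..t}|lborel. m t * g u) \<le> H t - H s"
      unfolding HD by (rule set_integral_mono[OF int_c int_st(2)])
        (use st m_anti nonneg in \<open>auto simp: mult.commute[of "g _"] intro!: mult_right_mono\<close>)
    then have H1: "m t * \<Delta> \<le> H t - H s"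
      by (simp add: \<Delta>)
    have "H t - H s \<le> (LINT u:{s<..t}|lborel. m s * g u)"
      unfolding HD by (rule set_integral_mono[OF int_st(2) int_c])
        (use st m_anti nonneg in \<open>auto simp: mult.commute[of "g _"] intro!: mult_right_mono\<close>)
    then have H2: "H t - H s \<le> m s * \<Delta>"
      by (simp add: \<Delta>)
    have e1: "m t = m s * exp (- \<Delta>)" and e2: "m s = m t * exp \<Delta>"
      by (simp_all add: m \<Delta>_def flip: exp_add)
    have E1: "m s - m t \<le> m s * \<Delta>"
      using mult_left_mono[OF exp_ge_add_one_self[of "- \<Delta>"], of "m s"] m_le(1)[of s]
      by (simp add: e1 algebra_simps)
    have E2: "m t * \<Delta> \<le> m s - m t"
      using mult_left_mono[OF exp_ge_add_one_self[of "\<Delta>"], of "m t"] m_le(1)[of t] e2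
      by (simp add: algebra_simps)
    have "\<bar>(m t + H t) - (m s + H s)\<bar> \<le> (m s - m t) * \<Delta>"
      using H1 H2 E1 E2 by (auto simp: algebra_simps abs_le_iff)
    also have "\<dots> \<le> \<Delta> * \<Delta>"
      using E1 mult_right_mono[OF m_le(2)[of s] \<Delta>0] by (intro mult_right_mono \<Delta>0) simp
    also have "\<dots> \<le> (C * (t - s)) * (C * (t - s))"
      by (intro mult_mono \<Delta>C \<Delta>0 order_trans[OF \<Delta>0 \<Delta>C])
    finally show "\<bar>(m t + H t) - (m s + H s)\<bar> \<le> C\<^sup>2 * (t - s)\<^sup>2"
      by (simp add: power2_eq_square algebra_simps)
  qed (use that in auto)
  from this[of a b] have "m a - m b = H b - H a"
    using ab by simp
  also have "\<dots> = (LINT u:{a<..b}|lborel. g u * m u)"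
    unfolding H_def by (rule split) (use ab int_gm in auto)
  also have "ennreal \<dots> = (\<integral>\<^sup>+t\<in>{a<..b}. ennreal (g t * m t) \<partial>lborel)"
    by (subst nn_integral_set_ennreal, subst nn_integral_eq_integral)
       (use Ioc[OF int_gm[of a b]] ab nonneg m_le in
         \<open>auto simp: set_integrable_def set_lebesgue_integral_def mult.commute less_imp_le
            intro!: AE_I2\<close>)
  finally show ?thesis ..
qed

lemma nn_integral_greaterThan_eq_SUP:
  fixes f :: "real \<Rightarrow> ennreal"
  assumes [measurable]: "f \<in> borel_measurable borel"
  shows "(\<integral>\<^sup>+t\<in>{a<..}. f t \<partial>lborel) = (SUP n::nat. \<integral>\<^sup>+t\<in>{a<..a + real n}. f t \<partial>lborel)"
proof -
  have *: "(\<integral>\<^sup>+t\<in>X. f t \<partial>lborel) = emeasure (density lborel f) X" if "X \<in> sets borel" for X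
    using that by (simp add: emeasure_density)
  have "emeasure (density lborel f) (\<Union>n. {a<..a + real n}) = (SUP n. emeasure (density lborel f) {a<..a + real n})"
    by (rule SUP_emeasure_incseq[symmetric]) (auto simp: incseq_def)
  moreover have "(\<Union>n. {a<..a + real n}) = {a<..}"
  proof -
    have "\<exists>n::nat. t \<le> a + real n" for t
      using real_arch_simple[of "t - a"] by (auto simp: algebra_simps)
    then show ?thesis by auto
  qed
  ultimately show ?thesis by (simp add: *)
qed

text \<open>Stieltjes measures are determined by their values on half-open intervals.\<close>

lemma interval_measure_eq_density:
  fixes F f :: "real \<Rightarrow> real"
  assumes [measurable]: "f \<in> borel_measurable borel"
    and mono: "\<And>s t. s \<le> t \<Longrightarrow> F s \<le> F t"
    and cont: "\<And>s. continuous (at_right s) F"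
    and eq: "\<And>s t. s \<le> t \<Longrightarrow> (\<integral>\<^sup>+u\<in>{s<..t}. ennreal (f u) \<partial>lborel) = ennreal (F t - F s)"
  shows "interval_measure F = density lborel (\<lambda>u. ennreal (f u))"
proof (rule measure_eqI_generator_eq[where E="range (\<lambda>(a, b). {a<..b})" and \<Omega>=UNIV
      and A="\<lambda>n. {- real n<..real n}"])
  show "Int_stable (range (\<lambda>(a, b). {a<..b::real}))"
    by (auto simp: Int_stable_def)
  fix X :: "real set" assume "X \<in> range (\<lambda>(a, b). {a<..b})"
  then obtain s t where X: "X = {s<..t}" by auto
  show "emeasure (interval_measure F) X = emeasure (density lborel (\<lambda>u. ennreal (f u))) X"
  proof (cases "s \<le> t")
    case True
    then show ?thesis
      by (simp add: X emeasure_interval_measure_Ioc[OF _ mono cont] emeasure_density eq)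
  qed (simp add: X)
next
  show "(\<Union>n. {- real n<..real n}) = UNIV"
  proof -
    have "\<exists>n::nat. \<bar>t\<bar> < real n" for t :: real by (rule reals_Archimedean2)
    then show ?thesis by (auto simp: abs_less_iff intro: less_imp_le) (metis less_imp_le minus_less_iff)
  qed
  show "emeasure (interval_measure F) {- real n<..real n} \<noteq> \<infinity>" for n
    by (simp add: emeasure_interval_measure_Ioc[OF _ mono cont])
qed (auto simp: borel_sigma_sets_Ioc)

section \<open>Path spaces\<close>

lemma space_cylinder_space [simp]:
  assumes "\<Omega> \<subseteq> extensional {0..}" shows "space (cylinder_space \<Omega>) = \<Omega>"
  using assms by (auto simp: cylinder_space_def space_restrict_space space_PiM PiE_def)

lemma cadlag_paths_extensional: "cadlag_paths \<subseteq> extensional {0..}"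
  by (auto simp: cadlag_paths_def)

lemma trapped_paths_extensional: "trapped_paths \<subseteq> extensional {0..}"
  by (auto simp: trapped_paths_def cadlag_paths_def)

lemmas space_path_space [simp] = space_cylinder_space[OF cadlag_paths_extensional]
lemmas space_augmented_space [simp] = space_cylinder_space[OF trapped_paths_extensional]

lemma measurable_cylinder_coordinate:
  assumes "0 \<le> t"
  shows "(\<lambda>\<omega>. \<omega> t) \<in> borel_measurable (cylinder_space \<Omega>)"
  unfolding cylinder_space_def
  by (rule measurable_restrict_space1, rule measurable_component_singleton) (use assms in auto)

lemma measurable_into_cylinder_space:
  assumes "\<Omega> \<subseteq> extensional {0..}"
    and "\<And>x. x \<in> space M \<Longrightarrow> f x \<in> \<Omega>"
    and "\<And>t. 0 \<le> t \<Longrightarrow> (\<lambda>x. f x t) \<in> borel_measurable M"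
  shows "f \<in> M \<rightarrow>\<^sub>M cylinder_space \<Omega>"
  unfolding cylinder_space_def
proof (rule measurable_restrict_space2)
  show "f \<in> space M \<rightarrow> \<Omega>" using assms(2) by auto
  have "(\<lambda>x. \<lambda>t\<in>{0..}. f x t) \<in> M \<rightarrow>\<^sub>M PiM {0..} (\<lambda>_. borel)"
    by (rule measurable_restrict) (use assms(3) in auto)
  moreover have "(\<lambda>x. \<lambda>t\<in>{0..}. f x t) x = f x" if "x \<in> space M" for x
    using assms(1,2) that by (auto simp: extensional_restrict dest!: subsetD)
  ultimately show "f \<in> M \<rightarrow>\<^sub>M PiM {0..} (\<lambda>_. borel)"
    by (simp cong: measurable_cong)
qed

text \<open>Evaluation is the limit of its values at the times \<open>q n t\<close> of a grid of mesh
  \<open>1 / Suc n\<close> that lie strictly to the right of \<open>t\<close>. Each of these depends on \<open>t\<close> through an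
  integer only, hence is measurable, and right-continuity identifies the limit.\<close>

lemma measurable_eval_path [measurable]:
  "(\<lambda>(\<omega> :: real \<Rightarrow> 'a::metric_space, t). \<omega> t) \<in> borel_measurable (path_space \<Otimes>\<^sub>M borel)"
  (is "?ev \<in> borel_measurable ?M")
proof (rule borel_measurable_LIMSEQ_metric)
  define q where "q n t = (of_int \<lfloor>real (Suc n) * t\<rfloor> + 1) / real (Suc n)" for n and t :: real
  define h where "h n = (\<lambda>(\<omega> :: real \<Rightarrow> 'a, t). if t < 0 then undefined else \<omega> (q n t))" for n
  show "h n \<in> borel_measurable ?M" for n
  proof -
    have coord: "(\<lambda>x. fst x (max 0 ((of_int k + 1) / real (Suc n)))) \<in> borel_measurable ?M" for k :: int
      by (rule measurable_compose[OF measurable_fst measurable_cylinder_coordinate]) simp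
    have "(\<lambda>x. fst x (max 0 ((of_int \<lfloor>real (Suc n) * snd x\<rfloor> + 1) / real (Suc n)))) \<in> borel_measurable ?M"
      by (rule measurable_compose_countable[OF coord]) measurable
    then have "(\<lambda>x. if snd x < 0 then undefined
        else fst x (max 0 ((of_int \<lfloor>real (Suc n) * snd x\<rfloor> + 1) / real (Suc n)))) \<in> borel_measurable ?M"
      by measurable
    also have "(\<lambda>x. if snd x < 0 then undefined
        else fst x (max 0 ((of_int \<lfloor>real (Suc n) * snd x\<rfloor> + 1) / real (Suc n)))) = h n"
      by (auto simp: h_def q_def fun_eq_iff max_def)
    finally show ?thesis .
  qed
  fix x assume "x \<in> space ?M"
  then obtain \<omega> t where x: "x = (\<omega>, t)" and \<omega>: "\<omega> \<in> cadlag_paths"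
    by (auto simp: space_pair_measure)
  show "(\<lambda>n. h n x) \<longlonglongrightarrow> ?ev x"
  proof (cases "t < 0")
    case True
    with \<omega> have "\<omega> t = undefined"
      by (auto simp: cadlag_paths_def extensional_def)
    with True show ?thesis by (simp add: h_def x)
  next
    case False
    then have "(\<omega> \<longlongrightarrow> \<omega> t) (at_right t)"
      using \<omega> by (auto simp: cadlag_paths_def cadlag_def)
    moreover have "filterlim (\<lambda>n. q n t) (at_right t) sequentially"
    proof (rule tendsto_imp_filterlim_at_right)
      have gt: "t < q n t" for n
        unfolding q_def by (simp add: pos_less_divide_eq mult.commute)
      have le: "q n t \<le> t + 1 / real (Suc n)" for n
      proof -
        have "q n t \<le> (real (Suc n) * t + 1) / real (Suc n)"
          unfolding q_def by (intro divide_right_mono) auto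
        then show ?thesis by (simp add: add_divide_distrib)
      qed
      show "\<forall>\<^sub>F n in sequentially. t < q n t"
        using gt by simp
      have "(\<lambda>n. t + 1 / real (Suc n)) \<longlonglongrightarrow> t + 0"
        by (intro tendsto_intros LIMSEQ_Suc[OF lim_1_over_n])
      then have "(\<lambda>n. t + 1 / real (Suc n)) \<longlonglongrightarrow> t"
        by (simp only: add_0_right)
      then show "(\<lambda>n. q n t) \<longlonglongrightarrow> t"
        by (rule tendsto_sandwich[OF always_eventually[OF allI[OF less_imp_le[OF gt]]]
              always_eventually[OF allI[OF le]] tendsto_const])
    qed
    ultimately show ?thesis
      using False by (auto simp: h_def x dest: filterlim_compose)
  qed
qed

text \<open>A bisection argument: near each time, the path stays either close to its value (on the
  right) or close to its left limit (on the left), and \<open>\<kappa>\<close> is bounded near these two points.\<close>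

lemma cadlag_locally_bounded_imp_bounded:
  assumes \<kappa>: "locally_bounded \<kappa>" and \<omega>: "cadlag \<omega>" and "0 \<le> T"
  obtains C where "\<And>t. t \<in> {0..T} \<Longrightarrow> \<bar>\<kappa> (\<omega> t)\<bar> \<le> C"
proof -
  define B where "B a b \<longleftrightarrow> (\<exists>C. \<forall>s\<in>{a..b} \<inter> {0..}. \<bar>\<kappa> (\<omega> s)\<bar> \<le> C)" for a b
  have nhd: "\<exists>C. \<forall>\<^sub>F s in F. \<bar>\<kappa> (\<omega> s)\<bar> \<le> C" if "(\<omega> \<longlongrightarrow> y) F" for y F
  proof -
    obtain U C where "open U" "y \<in> U" "\<forall>z\<in>U. \<bar>\<kappa> z\<bar> \<le> C"
      using \<kappa> by (metis locally_bounded_def)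
    with topological_tendstoD[OF that \<open>open U\<close> \<open>y \<in> U\<close>] show ?thesis
      by (auto elim!: eventually_mono)
  qed
  have "B 0 T"
    using \<open>0 \<le> T\<close>
  proof (induction rule: Bolzano)
    case (trans a b c)
    then obtain C1 C2 where
      C: "\<forall>s\<in>{a..b} \<inter> {0..}. \<bar>\<kappa> (\<omega> s)\<bar> \<le> C1" "\<forall>s\<in>{b..c} \<inter> {0..}. \<bar>\<kappa> (\<omega> s)\<bar> \<le> C2"
      by (auto simp: B_def)
    have "\<bar>\<kappa> (\<omega> s)\<bar> \<le> max C1 C2" if "s \<in> {a..c} \<inter> {0..}" for s
      using C that by (cases "s \<le> b") (auto simp: le_max_iff_disj)
    then show ?case unfolding B_def by blast
  next
    case (local x)
    obtain C1 r where r: "x < r" "\<And>s. x < s \<Longrightarrow> s < r \<Longrightarrow> \<bar>\<kappa> (\<omega> s)\<bar> \<le> C1"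
    proof -
      have "(\<omega> \<longlongrightarrow> \<omega> x) (at_right x)"
        using \<omega> local by (auto simp: cadlag_def)
      from nhd[OF this] that show ?thesis
        by (auto simp: eventually_at_right_field)
    qed
    obtain C2 l where l: "l < x" "\<And>s. 0 \<le> s \<Longrightarrow> l < s \<Longrightarrow> s < x \<Longrightarrow> \<bar>\<kappa> (\<omega> s)\<bar> \<le> C2"
    proof (cases "x = 0")
      case True
      \<comment> \<open>There are no times to the left of 0, so any negative bound serves.\<close>
      then show ?thesis using that[of "-1"] by auto
    next
      case False
      then obtain y where "(\<omega> \<longlongrightarrow> y) (at_left x)"
        using \<omega> local by (force simp: cadlag_def)
      from nhd[OF this] that show ?thesis
        by (auto simp: eventually_at_left_field)
    qed
    define C where "C = Max {C1, C2, \<bar>\<kappa> (\<omega> x)\<bar>}"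
    have "\<bar>\<kappa> (\<omega> s)\<bar> \<le> C" if "0 \<le> s" "l < s" "s < r" for s
    proof (cases s x rule: linorder_cases)
      case less
      then have "\<bar>\<kappa> (\<omega> s)\<bar> \<le> C2" using l that by auto
      also have "C2 \<le> C" by (simp add: C_def)
      finally show ?thesis .
    next
      case equal
      then show ?thesis by (simp add: C_def)
    next
      case greater
      then have "\<bar>\<kappa> (\<omega> s)\<bar> \<le> C1" using r that by auto
      also have "C1 \<le> C" by (simp add: C_def)
      finally show ?thesis .
    qed
    then have "B a b" if "a \<le> x" "x \<le> b" "b - a < min (x - l) (r - x)" for a b
      using that by (force simp: B_def)
    moreover have "0 < min (x - l) (r - x)" using l r by auto
    ultimately show ?case by blast
  qed
  then obtain C where "\<forall>s\<in>{0..T}. \<bar>\<kappa> (\<omega> s)\<bar> \<le> C"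
    by (auto simp: B_def)
  then show ?thesis by (intro that[of C]) auto
qed

section \<open>Killed paths\<close>

definition survival :: "('a \<Rightarrow> real) \<Rightarrow> (real \<Rightarrow> 'a) \<Rightarrow> real \<Rightarrow> real" where
  "survival \<kappa> \<omega> t = exp (- (LINT s:{0..t}|lborel. \<kappa> (\<omega> s)))"

text \<open>The value of \<open>kill_at t\<close> on an embedded unkilled path. It is written with \<open>min\<close> so
  that each coordinate is a single evaluation of \<open>\<omega>\<close> at a time measurable in \<open>t\<close>.\<close>

definition killed_path :: "real \<Rightarrow> (real \<Rightarrow> 'a) \<Rightarrow> (real \<Rightarrow> bool \<times> 'a)" where
  "killed_path t \<omega> = restrict (\<lambda>s. (t \<le> s, \<omega> (min s t))) {0..}"

definition location_path :: "(real \<Rightarrow> bool \<times> 'a) \<Rightarrow> (real \<Rightarrow> 'a)" where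
  "location_path \<omega> = restrict (\<lambda>s. snd (\<omega> s)) {0..}"

lemma killing_time_le: "fst (\<omega> s) \<Longrightarrow> 0 \<le> s \<Longrightarrow> killing_time \<omega> \<le> ennreal s"
  unfolding killing_time_def by (rule Inf_lower) auto

lemma not_killed_before: "0 \<le> s \<Longrightarrow> ennreal s < killing_time \<omega> \<Longrightarrow> \<not> fst (\<omega> s)"
  using killing_time_le[of \<omega> s] by auto

lemma killing_time_killed_path:
  assumes "0 \<le> t" shows "killing_time (killed_path t \<omega>) = ennreal t"
  unfolding killing_time_def
  by (rule antisym) (use assms in \<open>auto intro!: Inf_lower Inf_greatest simp: killed_path_def ennreal_leI\<close>)

lemma killing_location_killed_path:
  assumes "0 \<le> t" shows "killing_location (killed_path t \<omega>) = \<omega> t"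
  using assms by (simp add: killing_location_def killing_time_killed_path) (simp add: killed_path_def)

lemma killing_time_embed_path: "killing_time (embed_path \<omega>) = \<infinity>"
proof -
  have "{ennreal t |t. 0 \<le> t \<and> fst (embed_path \<omega> t)} = {}"
    by (auto simp: embed_path_def)
  then show ?thesis
    by (simp only: killing_time_def Inf_empty infinity_ennreal_def)
qed

lemma kill_at_embed_path:
  assumes "0 \<le> t" shows "kill_at t (embed_path \<omega>) = killed_path t \<omega>"
proof -
  have "ennreal t < killing_time (embed_path \<omega>)"
    by (simp add: killing_time_embed_path)
  then show ?thesis
    using assms by (auto simp: kill_at_def embed_path_def killed_path_def fun_eq_iff)
qed

lemma survival_weight_embed_path: "survival_weight \<kappa> (embed_path \<omega>) t = survival \<kappa> \<omega> t"
  unfolding survival_weight_def survival_def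
  by (simp, rule set_lebesgue_integral_cong) (auto simp: embed_path_def)

lemma location_path_embed_path: "\<omega> \<in> extensional {0..} \<Longrightarrow> location_path (embed_path \<omega>) = \<omega>"
  by (auto simp: location_path_def embed_path_def restrict_def extensional_def fun_eq_iff)

lemma embed_path_location_path:
  assumes "\<omega> \<in> extensional {0..}" "killing_time \<omega> = \<infinity>"
  shows "embed_path (location_path \<omega>) = \<omega>"
proof
  fix s
  have "\<not> fst (\<omega> s)" if "0 \<le> s"
    using not_killed_before[OF that, of \<omega>] assms(2) by simp
  then show "embed_path (location_path \<omega>) s = \<omega> s"
    using assms(1) by (cases "\<omega> s") (auto simp: location_path_def embed_path_def restrict_def extensional_def)
qed

lemma cadlag_restrict:
  assumes "\<And>t. 0 \<le> t \<Longrightarrow> (\<omega> \<longlongrightarrow> \<omega> t) (at_right t)"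
    and "\<And>t. 0 < t \<Longrightarrow> \<exists>l. (\<omega> \<longlongrightarrow> l) (at_left t)"
  shows "restrict \<omega> {0..} \<in> cadlag_paths"
proof -
  have "(restrict \<omega> {0..} \<longlongrightarrow> l) (at_right t) \<longleftrightarrow> (\<omega> \<longlongrightarrow> l) (at_right t)" if "0 \<le> t" for t l
    by (rule tendsto_cong) (use that in \<open>auto simp: eventually_at_right_field intro!: exI[of _ "t + 1"]\<close>)
  moreover have "(restrict \<omega> {0..} \<longlongrightarrow> l) (at_left t) \<longleftrightarrow> (\<omega> \<longlongrightarrow> l) (at_left t)" if "0 < t" for t l
    by (rule tendsto_cong) (use that in \<open>auto simp: eventually_at_left_field intro!: exI[of _ 0]\<close>)
  ultimately show ?thesis
    using assms by (auto simp: cadlag_paths_def cadlag_def)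
qed

lemma cadlag_pathsD:
  assumes "\<omega> \<in> cadlag_paths"
  shows "0 \<le> t \<Longrightarrow> (\<omega> \<longlongrightarrow> \<omega> t) (at_right t)"
    and "0 < t \<Longrightarrow> \<exists>l. (\<omega> \<longlongrightarrow> l) (at_left t)"
  using assms by (auto simp: cadlag_paths_def cadlag_def)

lemma location_path_in_cadlag_paths:
  assumes "\<omega> \<in> cadlag_paths" shows "location_path \<omega> \<in> cadlag_paths"
  unfolding location_path_def
proof (rule cadlag_restrict)
  show "((\<lambda>s. snd (\<omega> s)) \<longlongrightarrow> snd (\<omega> t)) (at_right t)" if "0 \<le> t" for t
    by (rule tendsto_snd[OF cadlag_pathsD(1)[OF assms that]])
  show "\<exists>l. ((\<lambda>s. snd (\<omega> s)) \<longlongrightarrow> l) (at_left t)" if "0 < t" for t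
    using cadlag_pathsD(2)[OF assms that] by (metis tendsto_snd)
qed

lemma embed_path_in_trapped_paths:
  assumes "\<omega> \<in> cadlag_paths" shows "embed_path \<omega> \<in> trapped_paths"
proof -
  have "embed_path \<omega> \<in> cadlag_paths"
    unfolding embed_path_def
  proof (rule cadlag_restrict)
    show "((\<lambda>s. (False, \<omega> s)) \<longlongrightarrow> (False, \<omega> t)) (at_right t)" if "0 \<le> t" for t
      by (rule tendsto_Pair[OF tendsto_const cadlag_pathsD(1)[OF assms that]])
    show "\<exists>l. ((\<lambda>s. (False, \<omega> s)) \<longlongrightarrow> l) (at_left t)" if "0 < t" for t
      using cadlag_pathsD(2)[OF assms that] tendsto_Pair[OF tendsto_const] by metis
  qed
  then show ?thesis
    by (simp add: trapped_paths_def killing_time_embed_path top_unique)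
qed

lemma killed_path_in_trapped_paths:
  assumes \<omega>: "\<omega> \<in> cadlag_paths" and t: "0 \<le> t"
  shows "killed_path t \<omega> \<in> trapped_paths"
proof -
  let ?k = "\<lambda>s. (t \<le> s, \<omega> (min s t))"
  have before: "(?k \<longlongrightarrow> l) F \<longleftrightarrow> ((\<lambda>s. (False, \<omega> s)) \<longlongrightarrow> l) F" if "\<forall>\<^sub>F s in F. s < t" for l F
    by (rule tendsto_cong) (use that in \<open>auto elim!: eventually_mono\<close>)
  have after: "(?k \<longlongrightarrow> (True, \<omega> t)) F" if "\<forall>\<^sub>F s in F. t \<le> s" for F
    by (rule tendsto_eventually) (use that in \<open>auto elim!: eventually_mono simp: min_def\<close>)
  have "killed_path t \<omega> \<in> cadlag_paths"
    unfolding killed_path_def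
  proof (rule cadlag_restrict)
    fix u :: real assume u: "0 \<le> u"
    show "(?k \<longlongrightarrow> ?k u) (at_right u)"
    proof (cases "u < t")
      case True
      then have "\<forall>\<^sub>F s in at_right u. s < t"
        by (auto simp: eventually_at_right_field)
      from before[OF this] True show ?thesis
        using tendsto_Pair[OF tendsto_const cadlag_pathsD(1)[OF \<omega> u]] by simp
    next
      case False
      then have "\<forall>\<^sub>F s in at_right u. t \<le> s"
        by (auto simp: eventually_at_right_field intro!: exI[of _ "u + 1"])
      from after[OF this] show ?thesis
        using False by (cases "u = t") (auto simp: min.absorb2)
    qed
  next
    fix u :: real assume u: "0 < u"
    show "\<exists>l. (?k \<longlongrightarrow> l) (at_left u)"
    proof (cases "u \<le> t")
      case True
      then have "\<forall>\<^sub>F s in at_left u. s < t"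
        by (auto simp: eventually_at_left_field intro!: exI[of _ "u - 1"])
      note before = before[OF this]
      obtain l where "(\<omega> \<longlongrightarrow> l) (at_left u)"
        using cadlag_pathsD(2)[OF \<omega> u] by blast
      then have "(?k \<longlongrightarrow> (False, l)) (at_left u)"
        unfolding before by (rule tendsto_Pair[OF tendsto_const])
      then show ?thesis by blast
    next
      case False
      then have "\<forall>\<^sub>F s in at_left u. t \<le> s"
        by (auto simp: eventually_at_left_field intro!: exI[of _ t])
      from after[OF this] show ?thesis by blast
    qed
  qed
  moreover have "killed_path t \<omega> s = killed_path t \<omega> t" if "0 \<le> s" "ennreal t \<le> ennreal s" for s
    using that t by (simp add: killed_path_def min.absorb2)
  ultimately show ?thesis
    unfolding trapped_paths_def mem_Collect_eq killing_time_killed_path[OF t] enn2real_ennreal[OF t]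
    by blast
qed

text \<open>Right-continuity forces the infimum defining the killing time to be attained, and the trap
  condition keeps the path killed from then on. So the killing time can be read off single coordinates,
  which makes it measurable.\<close>

lemma killing_time_le_iff:
  assumes \<omega>: "\<omega> \<in> trapped_paths" and s: "0 \<le> s"
  shows "killing_time \<omega> \<le> ennreal s \<longleftrightarrow> fst (\<omega> s)"
proof
  assume le: "killing_time \<omega> \<le> ennreal s"
  define r where "r = enn2real (killing_time \<omega>)"
  have \<tau>: "killing_time \<omega> = ennreal r" and r: "0 \<le> r"
    using le_less_trans[OF le ennreal_less_top] by (simp_all add: r_def)
  have "fst (\<omega> r)"
  proof (rule ccontr)
    assume not: "\<not> fst (\<omega> r)"
    have "(\<omega> \<longlongrightarrow> \<omega> r) (at_right r)"
      by (rule cadlag_pathsD(1)) (use \<omega> r in \<open>simp_all add: trapped_paths_def\<close>)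
    moreover have "open (fst -` {False} :: (bool \<times> 'a) set)"
      by (intro open_vimage_fst open_discrete)
    ultimately have "\<forall>\<^sub>F u in at_right r. \<omega> u \<in> fst -` {False}"
      by (rule topological_tendstoD) (use not in simp)
    \<comment> \<open>Were \<open>r\<close> not a killed time, there would be none up to some \<open>r'\<close> beyond the infimum.\<close>
    then obtain r' where r': "r < r'" "\<And>u. r < u \<Longrightarrow> u < r' \<Longrightarrow> \<not> fst (\<omega> u)"
      by (auto simp: eventually_at_right_field)
    have "ennreal r' \<le> killing_time \<omega>"
      unfolding killing_time_def
    proof (rule Inf_greatest, clarify)
      fix u assume u: "0 \<le> u" "fst (\<omega> u)"
      then have "r \<le> u"
        using killing_time_le[of \<omega> u] \<tau> by simp
      then have "r' \<le> u"
        using u not r'(2)[of u] by (cases "u = r"; cases "u < r'") auto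
      then show "ennreal r' \<le> ennreal u" by (rule ennreal_leI)
    qed
    with \<tau> r r' show False by simp
  qed
  moreover have "\<omega> s = \<omega> r"
    using \<omega> s le by (auto simp: trapped_paths_def r_def)
  ultimately show "fst (\<omega> s)" by simp
qed (rule killing_time_le[OF _ s])

lemma borel_measurable_snd_borel:
  "snd \<in> borel_measurable (borel :: (bool \<times> 'a::topological_space) measure)"
  by (intro borel_measurable_continuous_onI continuous_on_snd continuous_on_id)

lemma pred_fst_borel: "Measurable.pred (borel :: (bool \<times> 'a::topological_space) measure) fst"
proof -
  have "open (fst -` {True} :: (bool \<times> 'a) set)"
    by (intro open_vimage_fst open_discrete)
  moreover have "fst -` {True} = {z :: bool \<times> 'a. fst z}" by auto
  ultimately show ?thesis by (simp add: pred_def)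
qed

text \<open>The product \<open>\<sigma>\<close>-algebra need not be compared with the Borel sets of the product:
  the two branches are images under continuous embeddings.\<close>

lemma borel_measurable_Pair_bool:
  fixes f :: "'b \<Rightarrow> 'a::topological_space"
  assumes "Measurable.pred M p" and "f \<in> borel_measurable M"
  shows "(\<lambda>x. (p x, f x)) \<in> borel_measurable M"
proof -
  have c: "(\<lambda>x. (b, f x)) \<in> borel_measurable M" for b :: bool
    by (rule measurable_compose[OF assms(2) borel_measurable_continuous_onI]) (intro continuous_intros)
  have "(\<lambda>x. if p x then (True, f x) else (False, f x)) \<in> borel_measurable M"
    by (rule measurable_If[OF c c]) (use assms(1) in simp)
  also have "(\<lambda>x. if p x then (True, f x) else (False, f x)) = (\<lambda>x. (p x, f x))"
    by auto
  finally show ?thesis .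
qed

lemma measurable_augmented_coordinates:
  fixes t :: real
  assumes "0 \<le> t"
  shows "(\<lambda>\<omega>. snd (\<omega> t)) \<in> borel_measurable (augmented_space :: (real \<Rightarrow> bool \<times> 'a::topological_space) measure)"
    and "Measurable.pred (augmented_space :: (real \<Rightarrow> bool \<times> 'a::topological_space) measure) (\<lambda>\<omega>. fst (\<omega> t))"
  by (rule measurable_compose[OF measurable_cylinder_coordinate[OF assms]],
      rule borel_measurable_snd_borel pred_fst_borel)+

lemma measurable_killing_time [measurable]: "killing_time \<in> borel_measurable augmented_space"
proof (rule borel_measurableI_le)
  fix y :: ennreal
  show "{\<omega> \<in> space augmented_space. killing_time \<omega> \<le> y} \<in> sets augmented_space"
  proof (cases y)
    case (real r)
    then have "{\<omega> \<in> space augmented_space. killing_time \<omega> \<le> y} = {\<omega> \<in> space augmented_space. fst (\<omega> r)}"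
      by (auto simp: killing_time_le_iff)
    also have "\<dots> \<in> sets augmented_space"
      using measurable_augmented_coordinates(2)[OF real(1)] by (simp add: pred_def)
    finally show ?thesis .
  next
    case top
    then have "{\<omega> \<in> space augmented_space. killing_time \<omega> \<le> y} = space augmented_space" by auto
    then show ?thesis by (rule ssubst) (rule sets.top)
  qed
qed

text \<open>After the killing time a trapped path rests at its killing location, so the
  location is the limit of the path along integer times. On paths that are never killed the default value of
  \<^const>\<open>enn2real\<close> at infinity gives the location at time 0.\<close>

lemma measurable_killing_location [measurable]:
  "killing_location \<in> (augmented_space :: (real \<Rightarrow> bool \<times> 'a::metric_space) measure) \<rightarrow>\<^sub>M borel"
proof (rule borel_measurable_LIMSEQ_metric)
  let ?h = "\<lambda>n \<omega>. if fst (\<omega> (real n)) then snd (\<omega> (real n)) else snd (\<omega> 0) :: 'a"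
  show "?h n \<in> borel_measurable augmented_space" for n
    by (rule measurable_If[OF measurable_augmented_coordinates(1) measurable_augmented_coordinates(1)
          measurable_augmented_coordinates(2)[unfolded pred_def]]) simp_all
  fix \<omega> :: "real \<Rightarrow> bool \<times> 'a" assume "\<omega> \<in> space augmented_space"
  then have \<omega>: "\<omega> \<in> trapped_paths" by simp
  show "(\<lambda>n. ?h n \<omega>) \<longlonglongrightarrow> killing_location \<omega>"
  proof (cases "killing_time \<omega>")
    case (real r)
    obtain N :: nat where N: "r \<le> real N" using real_arch_simple by blast
    have "?h n \<omega> = killing_location \<omega>" if "N \<le> n" for n
    proof -
      have le: "killing_time \<omega> \<le> ennreal (real n)"
        using N that real by (auto intro: ennreal_leI)
      then have "fst (\<omega> (real n))"
        using killing_time_le_iff[OF \<omega>, of "real n"] by simp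
      moreover have "\<omega> (real n) = \<omega> (enn2real (killing_time \<omega>))"
        using \<omega> le of_nat_0_le_iff[of n] unfolding trapped_paths_def by blast
      ultimately show ?thesis by (simp only: killing_location_def if_True)
    qed
    then show ?thesis
      by (intro tendsto_eventually eventually_sequentiallyI)
  next
    case top
    have "\<not> fst (\<omega> (real n))" for n
      using killing_time_le_iff[OF \<omega>, of "real n"] top by (simp add: top_unique)
    with top show ?thesis
      by (simp add: killing_location_def)
  qed
qed

lemma measurable_embed_path [measurable]: "embed_path \<in> path_space \<rightarrow>\<^sub>M augmented_space"
proof (rule measurable_into_cylinder_space[OF trapped_paths_extensional])
  show "embed_path \<omega> \<in> trapped_paths" if "\<omega> \<in> space path_space" for \<omega> :: "real \<Rightarrow> 'a"
    using that by (simp add: embed_path_in_trapped_paths)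
  show "(\<lambda>\<omega>. embed_path \<omega> t) \<in> borel_measurable path_space" if "0 \<le> t" for t
    using that by (simp add: embed_path_def borel_measurable_Pair_bool measurable_cylinder_coordinate)
qed

lemma measurable_location_path [measurable]: "location_path \<in> augmented_space \<rightarrow>\<^sub>M path_space"
proof (rule measurable_into_cylinder_space[OF cadlag_paths_extensional])
  show "location_path \<omega> \<in> cadlag_paths" if "\<omega> \<in> space augmented_space" for \<omega> :: "real \<Rightarrow> bool \<times> 'a"
  proof -
    have "\<omega> \<in> trapped_paths" using that by simp
    then have "\<omega> \<in> cadlag_paths" by (simp add: trapped_paths_def)
    then show ?thesis by (rule location_path_in_cadlag_paths)
  qed
  show "(\<lambda>\<omega>. location_path \<omega> t) \<in> borel_measurable augmented_space" if "0 \<le> t" for t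
    using that by (simp add: location_path_def measurable_augmented_coordinates)
qed

lemma measurable_killed_path [measurable]:
  "(\<lambda>(\<omega> :: real \<Rightarrow> 'a::metric_space, t). killed_path (max 0 t) \<omega>) \<in> path_space \<Otimes>\<^sub>M borel \<rightarrow>\<^sub>M augmented_space"
proof (rule measurable_into_cylinder_space[OF trapped_paths_extensional])
  show "(case x of (\<omega>, t) \<Rightarrow> killed_path (max 0 t) \<omega>) \<in> trapped_paths"
    if "x \<in> space (path_space \<Otimes>\<^sub>M borel)" for x :: "(real \<Rightarrow> 'a) \<times> real"
    using that by (auto simp: space_pair_measure killed_path_in_trapped_paths)
  fix s :: real assume s: "0 \<le> s"
  have "(\<lambda>x. (max 0 (snd x) \<le> s, (\<lambda>(\<omega>, t). \<omega> t) (fst x, min s (max 0 (snd x)))))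
      \<in> borel_measurable ((path_space :: (real \<Rightarrow> 'a) measure) \<Otimes>\<^sub>M borel)"
    by (rule borel_measurable_Pair_bool) measurable
  also have "(\<lambda>x. (max 0 (snd x) \<le> s, (\<lambda>(\<omega>, t). \<omega> t) (fst x, min s (max 0 (snd x))))) =
      (\<lambda>x. (case x of (\<omega> :: real \<Rightarrow> 'a, t) \<Rightarrow> killed_path (max 0 t) \<omega>) s)"
    using s by (auto simp: killed_path_def)
  finally show "(\<lambda>x. (case x of (\<omega>, t) \<Rightarrow> killed_path (max 0 t) \<omega>) s)
      \<in> borel_measurable ((path_space :: (real \<Rightarrow> 'a) measure) \<Otimes>\<^sub>M borel)" .
qed

section \<open>Survival along a path\<close>

text \<open>The properties of the family of laws on which the computation rests; \<open>P x\<close> is the law of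
  the unkilled process started at \<open>x\<close>.\<close>

locale killed_process =
  fixes P :: "'a::polish_space \<Rightarrow> (real \<Rightarrow> 'a) measure" and \<kappa> :: "'a \<Rightarrow> real"
  assumes prob_space_law: "prob_space (P x)"
    and sets_law [measurable_cong]: "sets (P x) = sets path_space"
    and rate_measurable [measurable]: "\<kappa> \<in> borel_measurable borel"
    and rate_nonneg [simp]: "0 \<le> \<kappa> y"
    and rate_locally_bounded: "locally_bounded \<kappa>"
begin

lemma space_law [simp]: "space (P x) = cadlag_paths"
  using sets_eq_imp_space_eq[OF sets_law, of x] by simp

lemma measurable_path [measurable]: "\<omega> \<in> (cadlag_paths :: (real \<Rightarrow> 'a) set) \<Longrightarrow> (\<lambda>t. \<omega> t) \<in> borel_measurable borel"
  using measurable_compose[OF measurable_Pair1' measurable_eval_path, of \<omega>]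
  by simp

lemma measurable_survival [measurable]:
  "(\<lambda>(\<omega>, t). survival \<kappa> \<omega> t) \<in> borel_measurable (path_space \<Otimes>\<^sub>M borel)"
proof -
  have 1: "(\<lambda>y. (\<lambda>(\<omega>, t). \<omega> t) (fst (fst y), snd y)) \<in>
      ((path_space \<Otimes>\<^sub>M borel) \<Otimes>\<^sub>M borel) \<rightarrow>\<^sub>M (borel :: 'a measure)"
    by (rule measurable_compose[OF _ measurable_eval_path]) measurable
  have 2: "(\<lambda>(x, s). \<kappa> (fst x s)) \<in> borel_measurable ((path_space \<Otimes>\<^sub>M borel) \<Otimes>\<^sub>M borel)"
    using measurable_compose[OF 1 rate_measurable] by (simp add: case_prod_beta)
  have "(\<lambda>x. survival \<kappa> (fst x) (snd x)) \<in> borel_measurable (path_space \<Otimes>\<^sub>M borel)"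
    unfolding survival_def
    using borel_measurable_set_integral_Icc[OF 2 measurable_snd, of 0] by measurable
  then show ?thesis by (simp add: case_prod_beta)
qed

lemma measurable_rate_along [measurable]:
  "(\<lambda>(\<omega>, t). \<kappa> (\<omega> t)) \<in> borel_measurable (path_space \<Otimes>\<^sub>M borel)"
  using measurable_compose[OF measurable_eval_path rate_measurable] by (simp add: case_prod_beta)

lemma measurable_survival_path [measurable]:
  "\<omega> \<in> cadlag_paths \<Longrightarrow> survival \<kappa> \<omega> \<in> borel_measurable borel"
  using measurable_compose[OF measurable_Pair1' measurable_survival, of \<omega>] by simp

lemma rate_bounded_along:
  assumes "\<omega> \<in> cadlag_paths"
  obtains C where "0 \<le> C" "\<And>s. s \<in> {0..T} \<Longrightarrow> \<kappa> (\<omega> s) \<le> C"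
proof -
  obtain C where C: "\<And>s. s \<in> {0..max 0 T} \<Longrightarrow> \<bar>\<kappa> (\<omega> s)\<bar> \<le> C"
    using cadlag_locally_bounded_imp_bounded[OF rate_locally_bounded, of \<omega> "max 0 T"] assms
    by (auto simp: cadlag_paths_def)
  have "0 \<le> C" using order_trans[OF abs_ge_zero C[of 0]] by simp
  moreover have "\<kappa> (\<omega> s) \<le> C" if "s \<in> {0..T}" for s
    using C[of s] that by auto
  ultimately show ?thesis by (rule that)
qed

lemma survival_pos: "0 < survival \<kappa> \<omega> t"
  by (simp add: survival_def)

lemma survival_nonpos_time: "t \<le> 0 \<Longrightarrow> survival \<kappa> \<omega> t = 1"
proof -
  assume "t \<le> 0"
  then have "{0..t} = {} \<or> {0..t} = {0}" by auto
  then have "AE s in lborel. s \<notin> {0..t}"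
    using AE_lborel_singleton[of "0::real"] by auto
  then have "(LINT s:{0..t}|lborel. \<kappa> (\<omega> s)) = 0"
    unfolding set_lebesgue_integral_def
    by (intro integral_eq_zero_AE) (auto elim!: eventually_mono)
  then show ?thesis by (simp add: survival_def)
qed

lemma survival_antimono:
  assumes \<omega>: "\<omega> \<in> cadlag_paths" and "s \<le> t"
  shows "survival \<kappa> \<omega> t \<le> survival \<kappa> \<omega> s"
proof -
  obtain C where C: "0 \<le> C" "\<And>s. s \<in> {0..t} \<Longrightarrow> \<kappa> (\<omega> s) \<le> C"
    using rate_bounded_along[OF \<omega>] by blast
  show ?thesis
    using cumulative_integral_increment(1)[of "\<lambda>s. \<kappa> (\<omega> s)" t C s t] C \<omega> \<open>s \<le> t\<close>
    by (simp add: survival_def)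
qed

lemma survival_le_1: "\<omega> \<in> cadlag_paths \<Longrightarrow> survival \<kappa> \<omega> t \<le> 1"
  using survival_antimono[of \<omega> "min 0 t" t] by (simp add: survival_nonpos_time)

lemma continuous_survival:
  assumes \<omega>: "\<omega> \<in> cadlag_paths"
  shows "continuous (at_right t) (survival \<kappa> \<omega>)"
proof -
  define G where "G = (\<lambda>t. LINT s:{0..t}|lborel. \<kappa> (\<omega> s))"
  obtain C where C: "0 \<le> C" "\<And>s. s \<in> {0..t + 1} \<Longrightarrow> \<kappa> (\<omega> s) \<le> C"
    using rate_bounded_along[OF \<omega>] by blast
  have inc: "0 \<le> G u - G t \<and> G u - G t \<le> C * (u - t)" if "t \<le> u" "u \<le> t + 1" for u
    using cumulative_integral_increment[of "\<lambda>s. \<kappa> (\<omega> s)" "t + 1" C t u] C \<omega> that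
    by (simp add: G_def)
  have "((\<lambda>u. G u - G t) \<longlongrightarrow> 0) (at_right t)"
  proof (rule tendsto_sandwich[OF _ _ tendsto_const])
    have "((\<lambda>u. C * (u - t)) \<longlongrightarrow> C * (t - t)) (at_right t)"
      by (intro tendsto_intros)
    then show "((\<lambda>u. C * (u - t)) \<longlongrightarrow> 0) (at_right t)" by simp
  qed (use inc in \<open>auto simp: eventually_at_right_field intro!: exI[of _ "t + 1"]\<close>)
  then have "(G \<longlongrightarrow> G t) (at_right t)"
    by (rule LIM_zero_cancel)
  then have "((\<lambda>u. exp (- G u)) \<longlongrightarrow> exp (- G t)) (at_right t)"
    by (intro tendsto_intros)
  then show ?thesis
    unfolding continuous_within survival_def G_def .
qed

lemma killing_probability_between:
  assumes \<omega>: "\<omega> \<in> cadlag_paths" and "0 \<le> s" "s \<le> t"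
  shows "(\<integral>\<^sup>+u\<in>{s<..t}. ennreal (\<kappa> (\<omega> u) * survival \<kappa> \<omega> u) \<partial>lborel) =
    ennreal (survival \<kappa> \<omega> s - survival \<kappa> \<omega> t)"
proof -
  obtain C where C: "0 \<le> C" "\<And>s. s \<in> {0..t} \<Longrightarrow> \<kappa> (\<omega> s) \<le> C"
    using rate_bounded_along[OF \<omega>] by blast
  show ?thesis
    using survival_increment[of "\<lambda>s. \<kappa> (\<omega> s)" t C s] C assms
    by (simp add: survival_def)
qed

lemma killing_probability_le_1:
  assumes \<omega>: "\<omega> \<in> cadlag_paths"
  shows "(\<integral>\<^sup>+u\<in>{0<..}. ennreal (\<kappa> (\<omega> u) * survival \<kappa> \<omega> u) \<partial>lborel) \<le> 1"
proof -
  have "(\<integral>\<^sup>+u\<in>{0<..0 + real n}. ennreal (\<kappa> (\<omega> u) * survival \<kappa> \<omega> u) \<partial>lborel) \<le> 1" for n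
    using killing_probability_between[OF \<omega>, of 0 "real n"] survival_pos[of \<omega> "real n"]
    by (simp add: survival_nonpos_time)
  moreover have "(\<lambda>u. ennreal (\<kappa> (\<omega> u) * survival \<kappa> \<omega> u)) \<in> borel_measurable borel"
    using \<omega> by measurable
  ultimately show ?thesis
    by (subst nn_integral_greaterThan_eq_SUP) (auto intro: SUP_least)
qed

text \<open>If a path is killed with conditional probability one, then the mass of the killing times
  after \<open>t\<close> is the whole survival probability, since no mass escapes to infinity.\<close>

lemma killing_probability_after:
  assumes \<omega>: "\<omega> \<in> cadlag_paths" and "0 \<le> t"
    and total: "(\<integral>\<^sup>+u\<in>{0<..}. ennreal (\<kappa> (\<omega> u) * survival \<kappa> \<omega> u) \<partial>lborel) = 1"
  shows "(\<integral>\<^sup>+u\<in>{t<..}. ennreal (\<kappa> (\<omega> u) * survival \<kappa> \<omega> u) \<partial>lborel) = ennreal (survival \<kappa> \<omega> t)"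
    (is "?after = _")
proof -
  let ?f = "\<lambda>u. ennreal (\<kappa> (\<omega> u) * survival \<kappa> \<omega> u)"
  have [measurable]: "?f \<in> borel_measurable borel"
    using \<omega> by measurable
  have "ennreal (1 - survival \<kappa> \<omega> t) + ennreal (survival \<kappa> \<omega> t) = 1"
    using survival_le_1[OF \<omega>, of t] survival_pos[of \<omega> t] by (simp flip: ennreal_plus)
  also have "1 = (\<integral>\<^sup>+u\<in>{0<..t} \<union> {t<..}. ?f u \<partial>lborel)"
    using \<open>0 \<le> t\<close> by (simp add: total ivl_disj_un)
  also have "\<dots> = (\<integral>\<^sup>+u\<in>{0<..t}. ?f u \<partial>lborel) + ?after"
    by (rule nn_integral_disjoint_pair) auto
  also have "(\<integral>\<^sup>+u\<in>{0<..t}. ?f u \<partial>lborel) = ennreal (1 - survival \<kappa> \<omega> t)"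
    using killing_probability_between[OF \<omega>, of 0 t] \<open>0 \<le> t\<close> by (simp add: survival_nonpos_time)
  finally show ?thesis
    by (simp add: ennreal_add_left_cancel)
qed

text \<open>The density is supported on the open half-line, which agrees with the absence of an atom
  of $-dm_t$ at time 0.\<close>

lemma interval_measure_survival_weight:
  assumes \<omega>: "\<omega> \<in> cadlag_paths"
  shows "interval_measure (\<lambda>t. - survival_weight \<kappa> (embed_path \<omega>) t) =
    density lborel (\<lambda>t. ennreal (indicator {0<..} t * (\<kappa> (\<omega> t) * survival \<kappa> \<omega> t)))"
  unfolding survival_weight_embed_path
proof (rule interval_measure_eq_density)
  show "continuous (at_right t) (\<lambda>t. - survival \<kappa> \<omega> t)" for t
    by (rule continuous_minus[OF continuous_survival[OF \<omega>]])
  show "- survival \<kappa> \<omega> s \<le> - survival \<kappa> \<omega> t" if "s \<le> t" for s t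
    using survival_antimono[OF \<omega> that] by simp
  show "(\<lambda>t. indicator {0<..} t * (\<kappa> (\<omega> t) * survival \<kappa> \<omega> t)) \<in> borel_measurable borel"
    using \<omega> by measurable
  fix s t :: real assume st: "s \<le> t"
  have max_0: "survival \<kappa> \<omega> (max 0 u) = survival \<kappa> \<omega> u" for u
    by (cases "u \<le> 0") (simp_all add: max_def survival_nonpos_time)
  have "(\<integral>\<^sup>+u\<in>{s<..t}. ennreal (indicator {0<..} u * (\<kappa> (\<omega> u) * survival \<kappa> \<omega> u)) \<partial>lborel)
      = (\<integral>\<^sup>+u\<in>{max 0 s<..max 0 t}. ennreal (\<kappa> (\<omega> u) * survival \<kappa> \<omega> u) \<partial>lborel)"
    by (rule nn_integral_cong) (auto simp: indicator_def)
  also have "\<dots> = ennreal (survival \<kappa> \<omega> (max 0 s) - survival \<kappa> \<omega> (max 0 t))"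
    by (rule killing_probability_between[OF \<omega>]) (use st in auto)
  finally show "(\<integral>\<^sup>+u\<in>{s<..t}. ennreal (indicator {0<..} u * (\<kappa> (\<omega> u) * survival \<kappa> \<omega> u)) \<partial>lborel)
      = ennreal (- survival \<kappa> \<omega> t - - survival \<kappa> \<omega> s)"
    by (simp add: max_0)
qed

section \<open>The killed law as the image of a measure with a density\<close>

text \<open>The joint law of path and killing time, mapped to the killed path. The \<open>max\<close> makes
  the map send negative times, which carry no mass, to trapped paths as well.\<close>

definition killing_kernel :: "'a \<Rightarrow> (real \<Rightarrow> bool \<times> 'a) measure" where
  "killing_kernel x =
     distr
       (density (P x \<Otimes>\<^sub>M lborel)
         (\<lambda>(\<omega>, t). ennreal (\<kappa> (\<omega> t) * survival \<kappa> \<omega> t) * indicator {0<..} t))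
       augmented_space (\<lambda>(\<omega>, t). killed_path (max 0 t) \<omega>)"

lemma measurable_killing_density [measurable]:
  "(\<lambda>(\<omega>, t). ennreal (\<kappa> (\<omega> t) * survival \<kappa> \<omega> t) * indicator {0<..} t)
     \<in> borel_measurable (path_space \<Otimes>\<^sub>M borel)"
  using measurable_rate_along measurable_survival unfolding case_prod_beta by measurable

lemma measurable_killed_integrand:
  assumes [measurable]: "h \<in> borel_measurable augmented_space"
  shows "(\<lambda>(\<omega>, t). h (killed_path (max 0 t) \<omega>) * (ennreal (\<kappa> (\<omega> t) * survival \<kappa> \<omega> t) * indicator {0<..} t))
     \<in> borel_measurable (path_space \<Otimes>\<^sub>M borel)"
  using measurable_compose[OF measurable_killed_path assms] measurable_killing_density
  unfolding case_prod_beta by measurable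

text \<open>On the support of the killing times the truncation at 0 is invisible.\<close>

lemma set_nn_integral_max_0:
  fixes c :: "real \<Rightarrow> ennreal"
  shows "(\<integral>\<^sup>+t. h (killed_path (max 0 t) \<omega>) * (c t * indicator {0<..} t) \<partial>lborel) =
    (\<integral>\<^sup>+t\<in>{0<..}. h (killed_path t \<omega>) * c t \<partial>lborel)"
  by (rule nn_integral_cong) (auto simp: indicator_def max_def)

lemma measurable_killing_integral [measurable]:
  assumes h: "h \<in> borel_measurable augmented_space"
  shows "(\<lambda>\<omega>. \<integral>\<^sup>+t\<in>{0<..}. h (killed_path t \<omega>) * ennreal (\<kappa> (\<omega> t) * survival \<kappa> \<omega> t) \<partial>lborel)
     \<in> borel_measurable path_space"
proof -
  have "(\<lambda>(\<omega>, t). h (killed_path (max 0 t) \<omega>) * (ennreal (\<kappa> (\<omega> t) * survival \<kappa> \<omega> t) * indicator {0<..} t))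
     \<in> borel_measurable (path_space \<Otimes>\<^sub>M lborel)"
    using measurable_killed_integrand[OF h] by measurable
  from lborel.borel_measurable_nn_integral[OF this] show ?thesis
    by (simp only: set_nn_integral_max_0[where h=h])
qed

lemma nn_integral_killing_kernel:
  assumes h: "h \<in> borel_measurable augmented_space"
  shows "(\<integral>\<^sup>+\<omega>. h \<omega> \<partial>killing_kernel x) =
    (\<integral>\<^sup>+\<omega>. (\<integral>\<^sup>+t\<in>{0<..}. h (killed_path t \<omega>) * ennreal (\<kappa> (\<omega> t) * survival \<kappa> \<omega> t) \<partial>lborel) \<partial>P x)"
proof -
  note sets = sets_pair_measure_cong[OF sets_law sets_lborel, of x]
  note cong = measurable_cong_sets[OF sets refl]
  have T: "(\<lambda>(\<omega>, t). killed_path (max 0 t) \<omega>) \<in> P x \<Otimes>\<^sub>M lborel \<rightarrow>\<^sub>M augmented_space"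
    unfolding cong by (rule measurable_killed_path)
  have d: "(\<lambda>(\<omega>, t). ennreal (\<kappa> (\<omega> t) * survival \<kappa> \<omega> t) * indicator {0<..} t)
      \<in> borel_measurable (P x \<Otimes>\<^sub>M lborel)"
    unfolding cong by (rule measurable_killing_density)
  have hT: "(\<lambda>z. h (case z of (\<omega>, t) \<Rightarrow> killed_path (max 0 t) \<omega>)) \<in> borel_measurable (P x \<Otimes>\<^sub>M lborel)"
    by (rule measurable_compose[OF T h])
  have int: "(\<lambda>(\<omega>, t). h (killed_path (max 0 t) \<omega>) * (ennreal (\<kappa> (\<omega> t) * survival \<kappa> \<omega> t) * indicator {0<..} t))
      \<in> borel_measurable (P x \<Otimes>\<^sub>M lborel)"
    unfolding cong by (rule measurable_killed_integrand[OF h])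
  have "(\<integral>\<^sup>+\<omega>. h \<omega> \<partial>killing_kernel x) =
      (\<integral>\<^sup>+z. (\<lambda>(\<omega>, t). ennreal (\<kappa> (\<omega> t) * survival \<kappa> \<omega> t) * indicator {0<..} t) z *
         h (case z of (\<omega>, t) \<Rightarrow> killed_path (max 0 t) \<omega>) \<partial>(P x \<Otimes>\<^sub>M lborel))"
    unfolding killing_kernel_def
    by (subst nn_integral_distr) (use T h d hT in \<open>simp_all add: nn_integral_density\<close>)
  also have "\<dots> = (\<integral>\<^sup>+(\<omega>, t). h (killed_path (max 0 t) \<omega>) *
      (ennreal (\<kappa> (\<omega> t) * survival \<kappa> \<omega> t) * indicator {0<..} t) \<partial>(P x \<Otimes>\<^sub>M lborel))"
    by (rule nn_integral_cong) (auto simp: mult.commute)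
  also have "\<dots> = (\<integral>\<^sup>+\<omega>. (\<integral>\<^sup>+t\<in>{0<..}. h (killed_path t \<omega>) *
      ennreal (\<kappa> (\<omega> t) * survival \<kappa> \<omega> t) \<partial>lborel) \<partial>P x)"
    using lborel.nn_integral_fst[OF int] by (simp only: prod.case set_nn_integral_max_0[where h=h])
  finally show ?thesis .
qed

lemma sets_killing_kernel: "sets (killing_kernel x) = sets augmented_space"
  by (simp add: killing_kernel_def)

lemma nn_integral_stieltjes_kill_at:
  assumes \<omega>: "\<omega> \<in> cadlag_paths" and A: "A \<in> sets augmented_space"
  shows "(\<integral>\<^sup>+t\<in>{0..}. indicator A (kill_at t (embed_path \<omega>))
      \<partial>interval_measure (\<lambda>t. - survival_weight \<kappa> (embed_path \<omega>) t)) =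
    (\<integral>\<^sup>+t\<in>{0<..}. indicator A (killed_path t \<omega>) * ennreal (\<kappa> (\<omega> t) * survival \<kappa> \<omega> t) \<partial>lborel)"
proof -
  have "(\<lambda>t. (\<omega>, t)) \<in> borel \<rightarrow>\<^sub>M path_space \<Otimes>\<^sub>M borel"
    using \<omega> by (intro measurable_Pair1') simp
  from measurable_compose[OF measurable_compose[OF this measurable_killed_path] borel_measurable_indicator[OF A]]
  have m: "(\<lambda>t. indicator A (killed_path (max 0 t) \<omega>) :: ennreal) \<in> borel_measurable borel"
    by simp
  have d: "(\<lambda>t. ennreal (indicator {0<..} t * (\<kappa> (\<omega> t) * survival \<kappa> \<omega> t))) \<in> borel_measurable borel"
    using \<omega> by measurable
  have m': "(\<lambda>t. indicator A (killed_path (max 0 t) \<omega>) * indicator {0..} t :: ennreal) \<in> borel_measurable borel"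
    using m by measurable
  have "(\<integral>\<^sup>+t\<in>{0..}. indicator A (kill_at t (embed_path \<omega>))
      \<partial>interval_measure (\<lambda>t. - survival_weight \<kappa> (embed_path \<omega>) t)) =
    (\<integral>\<^sup>+t. indicator A (killed_path (max 0 t) \<omega>) * indicator {0..} t
      \<partial>density lborel (\<lambda>t. ennreal (indicator {0<..} t * (\<kappa> (\<omega> t) * survival \<kappa> \<omega> t))))"
    unfolding interval_measure_survival_weight[OF \<omega>]
    by (rule nn_integral_cong) (auto simp: indicator_def kill_at_embed_path)
  also have "\<dots> = (\<integral>\<^sup>+t. ennreal (indicator {0<..} t * (\<kappa> (\<omega> t) * survival \<kappa> \<omega> t)) *
      (indicator A (killed_path (max 0 t) \<omega>) * indicator {0..} t) \<partial>lborel)"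
    by (rule nn_integral_density) (use d m' in simp_all)
  also have "\<dots> = (\<integral>\<^sup>+t\<in>{0<..}. indicator A (killed_path t \<omega>) * ennreal (\<kappa> (\<omega> t) * survival \<kappa> \<omega> t) \<partial>lborel)"
    by (rule nn_integral_cong) (auto simp: indicator_def max_def)
  finally show ?thesis .
qed

lemma AE_unkilled_law_never_killed: "AE \<omega> in unkilled_law P x. killing_time \<omega> = \<infinity>"
proof -
  have "embed_path \<in> P x \<rightarrow>\<^sub>M augmented_space"
    unfolding measurable_cong_sets[OF sets_law refl] by (rule measurable_embed_path)
  moreover have "{\<omega> \<in> space augmented_space. killing_time \<omega> = \<infinity>} \<in> sets (augmented_space :: (real \<Rightarrow> bool \<times> 'a) measure)"
    by measurable
  ultimately show ?thesis
    unfolding unkilled_law_def by (subst AE_distr_iff) (auto simp: killing_time_embed_path)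
qed

text \<open>The unkilled law is carried by embedded paths, and on these the inner integral in the
  definition of the killed law is a measurable function of the location path. Replacing it by that function
  lets the outer integral be transported back to \<open>P x\<close>, and shows that the prescribed set function is
  a measure.\<close>

lemma killed_law_eq_killing_kernel: "killed_law \<kappa> P x = killing_kernel x"
proof -
  have "(\<integral>\<^sup>+\<omega>. (\<integral>\<^sup>+t\<in>{0..}. indicator A (kill_at t \<omega>)
        \<partial>interval_measure (\<lambda>t. - survival_weight \<kappa> \<omega> t)) \<partial>unkilled_law P x) = emeasure (killing_kernel x) A"
    if A: "A \<in> sets augmented_space" for A
  proof -
    define g where "g \<omega> = (\<integral>\<^sup>+t\<in>{0<..}. indicator A (killed_path t \<omega>) *
      ennreal (\<kappa> (\<omega> t) * survival \<kappa> \<omega> t) \<partial>lborel)" for \<omega>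
    have ind: "indicator A \<in> borel_measurable (augmented_space :: (real \<Rightarrow> bool \<times> 'a) measure)"
      using A by measurable
    have g: "g \<in> borel_measurable path_space"
      unfolding g_def by (rule measurable_killing_integral[OF ind])
    have emb: "embed_path \<in> P x \<rightarrow>\<^sub>M augmented_space"
      unfolding measurable_cong_sets[OF sets_law refl] by (rule measurable_embed_path)
    have "(\<integral>\<^sup>+\<omega>. (\<integral>\<^sup>+t\<in>{0..}. indicator A (kill_at t \<omega>)
        \<partial>interval_measure (\<lambda>t. - survival_weight \<kappa> \<omega> t)) \<partial>unkilled_law P x)
      = (\<integral>\<^sup>+\<omega>. g (location_path \<omega>) \<partial>unkilled_law P x)"
    proof (rule nn_integral_cong_AE, use AE_unkilled_law_never_killed AE_space in eventually_elim)
      fix \<omega> assume "\<omega> \<in> space (unkilled_law P x)" and \<tau>: "killing_time \<omega> = \<infinity>"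
      then have \<omega>: "\<omega> \<in> trapped_paths" by (simp add: unkilled_law_def)
      then have c: "\<omega> \<in> cadlag_paths" by (simp add: trapped_paths_def)
      have e: "embed_path (location_path \<omega>) = \<omega>"
        by (rule embed_path_location_path) (use c \<tau> in \<open>auto simp: cadlag_paths_def\<close>)
      show "(\<integral>\<^sup>+t\<in>{0..}. indicator A (kill_at t \<omega>)
          \<partial>interval_measure (\<lambda>t. - survival_weight \<kappa> \<omega> t)) = g (location_path \<omega>)"
        using nn_integral_stieltjes_kill_at[OF location_path_in_cadlag_paths[OF c] A]
        unfolding e g_def .
    qed
    also have "\<dots> = (\<integral>\<^sup>+\<omega>. g (location_path (embed_path \<omega>)) \<partial>P x)"
      unfolding unkilled_law_def
      by (rule nn_integral_distr[OF emb]) (simp add: measurable_compose[OF measurable_location_path g])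
    also have "\<dots> = (\<integral>\<^sup>+\<omega>. g \<omega> \<partial>P x)"
      by (rule nn_integral_cong) (simp add: location_path_embed_path cadlag_paths_def)
    also have "\<dots> = (\<integral>\<^sup>+\<omega>. indicator A \<omega> \<partial>killing_kernel x)"
      unfolding g_def by (rule nn_integral_killing_kernel[OF ind, symmetric])
    also have "\<dots> = emeasure (killing_kernel x) A"
      using A by (simp add: sets_killing_kernel)
    finally show ?thesis .
  qed
  then have "killed_law \<kappa> P x = measure_of (space augmented_space) (sets augmented_space) (emeasure (killing_kernel x))"
    unfolding killed_law_def by (intro measure_of_eq sets.space_closed) (simp only: sets.sigma_sets_eq)
  also have "\<dots> = killing_kernel x"
    using measure_of_of_measure[of "killing_kernel x"]
    by (simp only: sets_killing_kernel sets_eq_imp_space_eq[OF sets_killing_kernel])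
  finally show ?thesis .
qed

lemmas sets_killed_law = sets_killing_kernel[folded killed_law_eq_killing_kernel]
lemmas nn_integral_killed_law = nn_integral_killing_kernel[folded killed_law_eq_killing_kernel]

lemma emeasure_killed_law_space:
  "emeasure (killed_law \<kappa> P x) (space augmented_space) =
    (\<integral>\<^sup>+\<omega>. (\<integral>\<^sup>+t\<in>{0<..}. ennreal (\<kappa> (\<omega> t) * survival \<kappa> \<omega> t) \<partial>lborel) \<partial>P x)"
  using nn_integral_killed_law[of "\<lambda>_. 1" x] sets_eq_imp_space_eq[OF sets_killed_law, of x]
  by simp

lemma subprob_space_killed_law: "subprob_space (killed_law \<kappa> P x)"
proof
  have "emeasure (killed_law \<kappa> P x) (space augmented_space) \<le> (\<integral>\<^sup>+\<omega>. 1 \<partial>P x)"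
    unfolding emeasure_killed_law_space
    by (rule nn_integral_mono) (simp add: killing_probability_le_1)
  also have "\<dots> = 1"
    using prob_space.emeasure_space_1[OF prob_space_law, of x] by simp
  finally show "emeasure (killed_law \<kappa> P x) (space (killed_law \<kappa> P x)) \<le> 1"
    by (simp add: sets_eq_imp_space_eq[OF sets_killed_law])
  have "killed_path 0 \<omega> \<in> trapped_paths" if "\<omega> \<in> cadlag_paths" for \<omega> :: "real \<Rightarrow> 'a"
    using that by (rule killed_path_in_trapped_paths) simp
  then have "trapped_paths \<noteq> ({} :: (real \<Rightarrow> bool \<times> 'a) set)"
    using prob_space.not_empty[OF prob_space_law, of undefined] by auto
  then show "space (killed_law \<kappa> P x) \<noteq> {}"
    by (simp add: sets_eq_imp_space_eq[OF sets_killed_law])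
qed

lemma measurable_killed_law:
  assumes P: "P \<in> M \<rightarrow>\<^sub>M subprob_algebra path_space"
  shows "killed_law \<kappa> P \<in> M \<rightarrow>\<^sub>M subprob_algebra augmented_space"
proof (rule measurable_subprob_algebra)
  fix A :: "(real \<Rightarrow> bool \<times> 'a) set" assume A: "A \<in> sets augmented_space"
  then have ind: "indicator A \<in> borel_measurable (augmented_space :: (real \<Rightarrow> bool \<times> 'a) measure)"
    by measurable
  have "emeasure (killed_law \<kappa> P x) A = (\<integral>\<^sup>+\<omega>. (\<integral>\<^sup>+t\<in>{0<..}. indicator A (killed_path t \<omega>) *
      ennreal (\<kappa> (\<omega> t) * survival \<kappa> \<omega> t) \<partial>lborel) \<partial>P x)" for x
    using nn_integral_killed_law[OF ind, of x] A by (simp add: sets_killed_law)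
  then show "(\<lambda>x. emeasure (killed_law \<kappa> P x) A) \<in> borel_measurable M"
    by (simp add: measurable_compose[OF P nn_integral_measurable_subprob_algebra[OF measurable_killing_integral[OF ind]]])
qed (simp_all add: subprob_space_killed_law sets_killed_law)

end

section \<open>The resolvent and the law of the killing location\<close>

locale almost_surely_killed_process = killed_process +
  assumes almost_surely_killed:
    "emeasure (killed_law \<kappa> P x) {\<omega> \<in> space augmented_space. killing_time \<omega> < \<infinity>} = 1"
begin

text \<open>The mass of the killed law is the mean of the conditional killing probabilities, each at most one.
  As the mean is one, almost all of them are one: this is $m_\infty = 0$.\<close>

lemma AE_total_killing_probability:
  "AE \<omega> in P x. (\<integral>\<^sup>+t\<in>{0<..}. ennreal (\<kappa> (\<omega> t) * survival \<kappa> \<omega> t) \<partial>lborel) = 1"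
proof -
  interpret prob_space "P x" by (rule prob_space_law)
  define I where "I = (\<lambda>\<omega>. \<integral>\<^sup>+t\<in>{0<..}. ennreal (\<kappa> (\<omega> t) * survival \<kappa> \<omega> t) \<partial>lborel)"
  have "I \<in> borel_measurable path_space"
    using measurable_killing_integral[of "\<lambda>_. 1"] by (simp add: I_def)
  then have [measurable]: "I \<in> borel_measurable (P x)"
    unfolding measurable_cong_sets[OF sets_law refl] .
  have I_le: "I \<omega> \<le> 1" if "\<omega> \<in> space (P x)" for \<omega>
    using killing_probability_le_1[of \<omega>] that by (simp add: I_def)
  have "1 \<le> emeasure (killed_law \<kappa> P x) (space (killed_law \<kappa> P x))"
    using almost_surely_killed[of x] emeasure_space[of "killed_law \<kappa> P x"] by metis
  moreover have "emeasure (killed_law \<kappa> P x) (space (killed_law \<kappa> P x)) = integral\<^sup>N (P x) I"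
    unfolding sets_eq_imp_space_eq[OF sets_killed_law] emeasure_killed_law_space I_def ..
  moreover have "integral\<^sup>N (P x) I \<le> (\<integral>\<^sup>+\<omega>. 1 \<partial>P x)"
    by (rule nn_integral_mono) (rule I_le)
  ultimately have I: "integral\<^sup>N (P x) I = 1"
    using emeasure_space_1 by (simp add: antisym)
  have "(\<integral>\<^sup>+\<omega>. 1 - I \<omega> \<partial>P x) = (\<integral>\<^sup>+\<omega>. 1 \<partial>P x) - integral\<^sup>N (P x) I"
    by (rule nn_integral_diff) (auto simp: I I_le)
  also have "\<dots> = 0"
    using emeasure_space_1 by (simp add: I)
  finally have "AE \<omega> in P x. 1 - I \<omega> = 0"
    by (simp add: nn_integral_0_iff_AE)
  then have "AE \<omega> in P x. I \<omega> = 1"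
    using AE_space
  proof eventually_elim
    case (elim \<omega>)
    then show ?case using I_le[of \<omega>] by (simp add: diff_eq_0_iff_ennreal antisym)
  qed
  then show ?thesis by (simp add: I_def)
qed

lemma emeasure_killed_law_space_eq_1: "emeasure (killed_law \<kappa> P x) (space augmented_space) = 1"
proof -
  have "emeasure (killed_law \<kappa> P x) (space augmented_space) = (\<integral>\<^sup>+\<omega>. 1 \<partial>P x)"
    unfolding emeasure_killed_law_space
    by (rule nn_integral_cong_AE) (use AE_total_killing_probability[of x] in auto)
  then show ?thesis
    using prob_space.emeasure_space_1[OF prob_space_law, of x] by simp
qed

text \<open>A path killed at time \<open>s\<close> contributes \<open>f (\<omega> t)\<close> exactly if \<open>s > t\<close>,
  so the factor multiplying \<open>f (\<omega> t)\<close> is the probability of being killed after \<open>t\<close>.\<close>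

lemma killed_semigroup_eq:
  assumes f: "f \<in> borel_measurable borel" and t: "0 \<le> t"
  shows "killed_semigroup \<kappa> P t f x = (\<integral>\<^sup>+\<omega>. f (\<omega> t) * ennreal (survival \<kappa> \<omega> t) \<partial>P x)"
proof -
  have [measurable]: "(\<lambda>\<omega>. f (snd (\<omega> t))) \<in> borel_measurable (augmented_space :: (real \<Rightarrow> bool \<times> 'a) measure)"
    by (rule measurable_compose[OF measurable_augmented_coordinates(1)[OF t] f])
  have "(\<lambda>\<omega>. if ennreal t < killing_time \<omega> then f (snd (\<omega> t)) else 0)
      \<in> borel_measurable (augmented_space :: (real \<Rightarrow> bool \<times> 'a) measure)"
    by measurable
  moreover have "(\<lambda>\<omega>. if ennreal t < killing_time \<omega> then f (snd (\<omega> t)) else 0) =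
      (\<lambda>\<omega> :: real \<Rightarrow> bool \<times> 'a. f (snd (\<omega> t)) * indicator {\<omega>. ennreal t < killing_time \<omega>} \<omega>)"
    by (auto simp: indicator_def)
  ultimately have h: "(\<lambda>\<omega>. f (snd (\<omega> t)) * indicator {\<omega>. ennreal t < killing_time \<omega>} \<omega>)
      \<in> borel_measurable (augmented_space :: (real \<Rightarrow> bool \<times> 'a) measure)"
    by simp
  show ?thesis
    unfolding killed_semigroup_def nn_integral_killed_law[OF h]
  proof (rule nn_integral_cong_AE, use AE_total_killing_probability AE_space in eventually_elim)
    fix \<omega> assume "\<omega> \<in> space (P x)"
      and total: "(\<integral>\<^sup>+t\<in>{0<..}. ennreal (\<kappa> (\<omega> t) * survival \<kappa> \<omega> t) \<partial>lborel) = 1"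
    then have \<omega>: "\<omega> \<in> cadlag_paths" by simp
    have m: "(\<lambda>s. ennreal (\<kappa> (\<omega> s) * survival \<kappa> \<omega> s) * indicator {t<..} s) \<in> borel_measurable borel"
      using \<omega> by measurable
    have "(\<integral>\<^sup>+s\<in>{0<..}. f (snd (killed_path s \<omega> t)) *
          indicator {\<omega>. ennreal t < killing_time \<omega>} (killed_path s \<omega>) *
          ennreal (\<kappa> (\<omega> s) * survival \<kappa> \<omega> s) \<partial>lborel) =
        (\<integral>\<^sup>+s. f (\<omega> t) * (ennreal (\<kappa> (\<omega> s) * survival \<kappa> \<omega> s) * indicator {t<..} s) \<partial>lborel)"
    proof (rule nn_integral_cong)
      fix s :: real
      show "f (snd (killed_path s \<omega> t)) * indicator {\<omega>. ennreal t < killing_time \<omega>} (killed_path s \<omega>) *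
            ennreal (\<kappa> (\<omega> s) * survival \<kappa> \<omega> s) * indicator {0<..} s =
          f (\<omega> t) * (ennreal (\<kappa> (\<omega> s) * survival \<kappa> \<omega> s) * indicator {t<..} s)"
      proof (cases "0 < s")
        case True
        then have "killing_time (killed_path s \<omega>) = ennreal s"
          by (intro killing_time_killed_path) simp
        moreover have "snd (killed_path s \<omega> t) = \<omega> t" if "t < s"
          using that t by (simp add: killed_path_def)
        ultimately show ?thesis
          using True t by (auto simp: indicator_def ennreal_less_iff mult.assoc)
      next
        case False
        with t show ?thesis by (simp add: indicator_def)
      qed
    qed
    also have "\<dots> = f (\<omega> t) * (\<integral>\<^sup>+s. ennreal (\<kappa> (\<omega> s) * survival \<kappa> \<omega> s) * indicator {t<..} s \<partial>lborel)"
      by (rule nn_integral_cmult) (use m in simp)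
    also have "\<dots> = f (\<omega> t) * ennreal (survival \<kappa> \<omega> t)"
      by (simp add: killing_probability_after[OF \<omega> t total])
    finally show "(\<integral>\<^sup>+s\<in>{0<..}. f (snd (killed_path s \<omega> t)) *
          indicator {\<omega>. ennreal t < killing_time \<omega>} (killed_path s \<omega>) *
          ennreal (\<kappa> (\<omega> s) * survival \<kappa> \<omega> s) \<partial>lborel) = f (\<omega> t) * ennreal (survival \<kappa> \<omega> t)" .
  qed
qed

lemma measurable_surviving_integrand:
  assumes f: "f \<in> borel_measurable borel"
  shows "(\<lambda>(\<omega>, t). f (\<omega> t) * ennreal (survival \<kappa> \<omega> t) * indicator {0<..} t)
    \<in> borel_measurable (path_space \<Otimes>\<^sub>M borel)"
  using measurable_compose[OF measurable_eval_path f] measurable_survival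
  unfolding case_prod_beta by measurable

lemma resolvent_eq:
  assumes f: "f \<in> borel_measurable borel"
  shows "resolvent \<kappa> P f x =
    (\<integral>\<^sup>+\<omega>. (\<integral>\<^sup>+t\<in>{0<..}. f (\<omega> t) * ennreal (survival \<kappa> \<omega> t) \<partial>lborel) \<partial>P x)"
proof -
  interpret prob_space "P x" by (rule prob_space_law)
  interpret pair_sigma_finite "P x" lborel ..
  note cong = measurable_cong_sets[OF sets_pair_measure_cong[OF sets_law sets_lborel] refl]
  have joint: "(\<lambda>(\<omega>, t). f (\<omega> t) * ennreal (survival \<kappa> \<omega> t) * indicator {0<..} t)
      \<in> borel_measurable (P x \<Otimes>\<^sub>M lborel)"
    unfolding cong by (rule measurable_surviving_integrand[OF f])
  have "resolvent \<kappa> P f x =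
      (\<integral>\<^sup>+t. (\<integral>\<^sup>+\<omega>. f (\<omega> t) * ennreal (survival \<kappa> \<omega> t) * indicator {0<..} t \<partial>P x) \<partial>lborel)"
    unfolding resolvent_def
  proof (rule nn_integral_cong_AE, use AE_lborel_singleton[of "0::real"] in eventually_elim)
    fix t :: real assume "t \<noteq> 0"
    then show "killed_semigroup \<kappa> P t f x * indicator {0..} t =
        (\<integral>\<^sup>+\<omega>. f (\<omega> t) * ennreal (survival \<kappa> \<omega> t) * indicator {0<..} t \<partial>P x)"
      by (cases "0 < t") (auto simp: killed_semigroup_eq[OF f])
  qed
  also have "\<dots> = (\<integral>\<^sup>+\<omega>. (\<integral>\<^sup>+t\<in>{0<..}. f (\<omega> t) * ennreal (survival \<kappa> \<omega> t) \<partial>lborel) \<partial>P x)"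
    by (rule Fubini'[OF joint])
  finally show ?thesis .
qed

text \<open>The path killed at \<open>t\<close> has killing location \<open>\<omega> t\<close>, and the density of \<open>t\<close>
  is the rate times the survival probability that weighs the resolvent.\<close>

lemma killing_location_distribution:
  assumes A: "A \<in> sets borel"
  shows "emeasure (killed_law \<kappa> P x) {\<omega> \<in> space augmented_space. killing_location \<omega> \<in> A} =
    resolvent \<kappa> P (\<lambda>y. ennreal (\<kappa> y) * indicator A y) x"
proof -
  let ?B = "{\<omega> \<in> space augmented_space. killing_location \<omega> \<in> A}"
  have B: "?B \<in> sets augmented_space"
    using A by measurable
  then have ind: "indicator ?B \<in> borel_measurable augmented_space"
    by measurable
  have f: "(\<lambda>y. ennreal (\<kappa> y) * indicator A y) \<in> borel_measurable borel"
    using A by measurable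
  have "emeasure (killed_law \<kappa> P x) ?B = (\<integral>\<^sup>+\<omega>. indicator ?B \<omega> \<partial>killed_law \<kappa> P x)"
    using B by (simp add: sets_killed_law)
  also have "\<dots> = (\<integral>\<^sup>+\<omega>. (\<integral>\<^sup>+t\<in>{0<..}. indicator ?B (killed_path t \<omega>) *
      ennreal (\<kappa> (\<omega> t) * survival \<kappa> \<omega> t) \<partial>lborel) \<partial>P x)"
    by (rule nn_integral_killed_law[OF ind])
  also have "\<dots> = (\<integral>\<^sup>+\<omega>. (\<integral>\<^sup>+t\<in>{0<..}. ennreal (\<kappa> (\<omega> t)) * indicator A (\<omega> t) *
      ennreal (survival \<kappa> \<omega> t) \<partial>lborel) \<partial>P x)"
  proof (intro nn_integral_cong)
    fix \<omega> and t :: real assume "\<omega> \<in> space (P x)"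
    then have "killed_path t \<omega> \<in> trapped_paths" if "0 < t"
      using that by (intro killed_path_in_trapped_paths) auto
    then show "indicator ?B (killed_path t \<omega>) * ennreal (\<kappa> (\<omega> t) * survival \<kappa> \<omega> t) * indicator {0<..} t =
        ennreal (\<kappa> (\<omega> t)) * indicator A (\<omega> t) * ennreal (survival \<kappa> \<omega> t) * indicator {0<..} t"
      using less_imp_le[OF survival_pos, of \<omega> t]
      by (cases "0 < t") (auto simp: indicator_def killing_location_killed_path ennreal_mult)
  qed
  also have "\<dots> = resolvent \<kappa> P (\<lambda>y. ennreal (\<kappa> y) * indicator A y) x"
    by (rule resolvent_eq[OF f, symmetric])
  finally show ?thesis .
qed

end

section \<open>Mixing over the initial distribution\<close>

text \<open>Both sides agree on measurable sets, and the right-hand side is known to be a measure. The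
  definition by values on sets therefore describes a genuine law.\<close>

lemma mixed_law_eq_bind:
  assumes K: "K \<in> completion \<mu> \<rightarrow>\<^sub>M subprob_algebra N" and ne: "space \<mu> \<noteq> {}"
  shows "mixed_law N K \<mu> = completion \<mu> \<bind> K"
proof -
  have sets: "sets (completion \<mu> \<bind> K) = sets N"
    by (rule sets_bind[OF sets_kernel[OF K]]) (simp_all add: ne)
  have "mixed_law N K \<mu> = measure_of (space N) (sets N) (emeasure (completion \<mu> \<bind> K))"
    unfolding mixed_law_def
    by (intro measure_of_eq sets.space_closed)
       (simp only: sets.sigma_sets_eq, rule emeasure_bind[OF _ K, symmetric], simp_all add: ne)
  also have "\<dots> = completion \<mu> \<bind> K"
    using measure_of_of_measure[of "completion \<mu> \<bind> K"]
    by (simp only: sets sets_eq_imp_space_eq[OF sets])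
  finally show ?thesis .
qed

context almost_surely_killed_process
begin

text \<open>The measure $\mu\mathcal R$. Mixing over the completion of \<open>\<mu>\<close> accounts for the laws
  depending on the starting point in a universally measurable way only. Defined as an image measure, it is
  countably additive by construction.\<close>

definition occupation_measure :: "'a measure \<Rightarrow> 'a measure" where
  "occupation_measure \<mu> =
     distr
       (density ((completion \<mu> \<bind> P) \<Otimes>\<^sub>M lborel)
         (\<lambda>(\<omega>, t). ennreal (survival \<kappa> \<omega> t) * indicator {0<..} t))
       borel (\<lambda>(\<omega>, t). \<omega> t)"

lemma nn_integral_occupation_measure:
  assumes P: "P \<in> completion \<mu> \<rightarrow>\<^sub>M subprob_algebra path_space" and ne: "space \<mu> \<noteq> {}"
    and f: "f \<in> borel_measurable borel"
  shows "(\<integral>\<^sup>+y. f y \<partial>occupation_measure \<mu>) = resolvent_from \<kappa> P \<mu> f"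
proof -
  let ?Q = "completion \<mu> \<bind> P"
  have "sets ?Q = sets path_space"
    by (rule sets_bind[OF sets_kernel[OF P]]) (simp_all add: ne)
  note cong = measurable_cong_sets[OF sets_pair_measure_cong[OF this sets_lborel] refl]
  have ev: "(\<lambda>(\<omega>, t). \<omega> t) \<in> ?Q \<Otimes>\<^sub>M lborel \<rightarrow>\<^sub>M borel"
    unfolding cong by (rule measurable_eval_path)
  have d: "(\<lambda>(\<omega>, t). ennreal (survival \<kappa> \<omega> t) * indicator {0<..} t) \<in> borel_measurable (?Q \<Otimes>\<^sub>M lborel)"
    unfolding cong using measurable_surviving_integrand[of "\<lambda>_. 1"] by simp
  have joint: "(\<lambda>(\<omega>, t). f (\<omega> t) * ennreal (survival \<kappa> \<omega> t) * indicator {0<..} t)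
      \<in> borel_measurable (path_space \<Otimes>\<^sub>M lborel)"
    using measurable_surviving_integrand[OF f] by measurable
  then have joint': "(\<lambda>(\<omega>, t). f (\<omega> t) * ennreal (survival \<kappa> \<omega> t) * indicator {0<..} t)
      \<in> borel_measurable (?Q \<Otimes>\<^sub>M lborel)"
    unfolding cong by measurable
  have F: "(\<lambda>\<omega>. \<integral>\<^sup>+t\<in>{0<..}. f (\<omega> t) * ennreal (survival \<kappa> \<omega> t) \<partial>lborel) \<in> borel_measurable path_space"
    using lborel.borel_measurable_nn_integral[OF joint] .
  have "(\<integral>\<^sup>+y. f y \<partial>occupation_measure \<mu>) =
      (\<integral>\<^sup>+z. (case z of (\<omega>, t) \<Rightarrow> ennreal (survival \<kappa> \<omega> t) * indicator {0<..} t) *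
        f (case z of (\<omega>, t) \<Rightarrow> \<omega> t) \<partial>(?Q \<Otimes>\<^sub>M lborel))"
    unfolding occupation_measure_def
    by (subst nn_integral_distr) (use ev f d measurable_compose[OF ev f] in \<open>simp_all add: nn_integral_density\<close>)
  also have "\<dots> = (\<integral>\<^sup>+(\<omega>, t). f (\<omega> t) * ennreal (survival \<kappa> \<omega> t) * indicator {0<..} t \<partial>(?Q \<Otimes>\<^sub>M lborel))"
    by (rule nn_integral_cong) (auto simp: ac_simps)
  also have "\<dots> = (\<integral>\<^sup>+\<omega>. (\<integral>\<^sup>+t\<in>{0<..}. f (\<omega> t) * ennreal (survival \<kappa> \<omega> t) \<partial>lborel) \<partial>?Q)"
    using lborel.nn_integral_fst[OF joint'] by simp
  also have "\<dots> = resolvent_from \<kappa> P \<mu> f"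
    unfolding resolvent_from_def resolvent_eq[OF f] by (rule nn_integral_bind[OF F P])
  finally show ?thesis .
qed

lemma resurrection_invariant_eq:
  assumes P: "P \<in> completion \<mu> \<rightarrow>\<^sub>M subprob_algebra path_space" and ne: "space \<mu> \<noteq> {}"
  shows "resurrection_invariant \<kappa> P \<mu> =
    scale_measure (inverse (resolvent_from \<kappa> P \<mu> (\<lambda>_. 1))) (occupation_measure \<mu>)"
proof -
  have "resolvent_from \<kappa> P \<mu> (indicator A) / resolvent_from \<kappa> P \<mu> (\<lambda>_. 1) =
      inverse (resolvent_from \<kappa> P \<mu> (\<lambda>_. 1)) * emeasure (occupation_measure \<mu>) A"
    if A: "A \<in> sets borel" for A
    using nn_integral_occupation_measure[OF P ne, of "indicator A"] A
    by (simp add: occupation_measure_def divide_ennreal_def mult.commute)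
  moreover have "space (occupation_measure \<mu>) = UNIV" "sets (occupation_measure \<mu>) = sets borel"
    by (simp_all add: occupation_measure_def)
  ultimately show ?thesis
    unfolding resurrection_invariant_def scale_measure_def
    by (simp only:) (intro measure_of_eq; simp add: sets.sigma_sets_eq[of borel, simplified])
qed

lemma emeasure_killed_law_from:
  assumes P: "P \<in> completion \<mu> \<rightarrow>\<^sub>M subprob_algebra path_space" and ne: "space \<mu> \<noteq> {}"
    and A: "A \<in> sets borel"
  shows "emeasure (killed_law_from \<kappa> P \<mu>) {\<omega> \<in> space augmented_space. killing_location \<omega> \<in> A} =
    (\<integral>\<^sup>+y\<in>A. ennreal (\<kappa> y) \<partial>occupation_measure \<mu>)"
proof -
  let ?B = "{\<omega> \<in> space augmented_space. killing_location \<omega> \<in> A}"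
  have "?B \<in> sets augmented_space"
    using A by measurable
  then have "emeasure (killed_law_from \<kappa> P \<mu>) ?B = (\<integral>\<^sup>+x. emeasure (killed_law \<kappa> P x) ?B \<partial>completion \<mu>)"
    unfolding killed_law_from_def mixed_law_eq_bind[OF measurable_killed_law[OF P] ne]
    by (intro emeasure_bind[OF _ measurable_killed_law[OF P]]) (simp_all add: ne)
  also have "\<dots> = resolvent_from \<kappa> P \<mu> (\<lambda>y. ennreal (\<kappa> y) * indicator A y)"
    unfolding resolvent_from_def killing_location_distribution[OF A] ..
  also have "\<dots> = (\<integral>\<^sup>+y\<in>A. ennreal (\<kappa> y) \<partial>occupation_measure \<mu>)"
    by (rule nn_integral_occupation_measure[OF P ne, symmetric]) (use A in measurable)
  finally show ?thesis .
qed

text \<open>The killing location lies somewhere with probability one.\<close>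

lemma nn_integral_rate_occupation_measure:
  assumes P: "P \<in> completion \<mu> \<rightarrow>\<^sub>M subprob_algebra path_space" and \<mu>: "prob_space \<mu>"
  shows "(\<integral>\<^sup>+y. ennreal (\<kappa> y) \<partial>occupation_measure \<mu>) = 1"
proof -
  have ne: "space \<mu> \<noteq> {}" by (rule prob_space.not_empty[OF \<mu>])
  have "(\<integral>\<^sup>+y. ennreal (\<kappa> y) \<partial>occupation_measure \<mu>) = resolvent_from \<kappa> P \<mu> (\<lambda>y. ennreal (\<kappa> y))"
    by (rule nn_integral_occupation_measure[OF P ne]) measurable
  also have "\<dots> = (\<integral>\<^sup>+x. 1 \<partial>completion \<mu>)"
    unfolding resolvent_from_def
    using killing_location_distribution[of UNIV] emeasure_killed_law_space_eq_1
    by (intro nn_integral_cong) simp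
  also have "\<dots> = 1"
    using prob_space.emeasure_space_1[OF \<mu>] by (simp add: emeasure_completion)
  finally show ?thesis .
qed

end

theorem corollary3p2:
  fixes P :: "'a::polish_space \<Rightarrow> (real \<Rightarrow> 'a) measure"
    and \<kappa> :: "'a \<Rightarrow> real"
    and \<mu> :: "'a measure"
    and A :: "'a set"
  assumes "cadlag_right_process P"
    and "\<kappa> \<in> borel_measurable borel" and "\<And>x. 0 \<le> \<kappa> x" and "locally_bounded \<kappa>"
    and "\<And>x. emeasure (killed_law \<kappa> P x)
                {\<omega> \<in> space augmented_space. killing_time \<omega> < \<infinity>} = 1"
    and "prob_space \<mu>" and "sets \<mu> = sets borel"
    and "resolvent_from \<kappa> P \<mu> (\<lambda>_. 1) < \<infinity>"
    and "A \<in> sets borel"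
  shows "emeasure (killed_law_from \<kappa> P \<mu>)
           {\<omega> \<in> space augmented_space. killing_location \<omega> \<in> A} =
         (\<integral>\<^sup>+x\<in>A. ennreal (\<kappa> x) \<partial>resurrection_invariant \<kappa> P \<mu>) /
         (\<integral>\<^sup>+x. ennreal (\<kappa> x) \<partial>resurrection_invariant \<kappa> P \<mu>)"
proof -
  have law: "prob_space (P x)" "sets (P x) = sets path_space" for x
    using assms(1) unfolding cadlag_right_process_def by blast+
  have univ: "universally_measurable (\<lambda>x. emeasure (P x) B)" if "B \<in> sets path_space" for B
    using assms(1) that unfolding cadlag_right_process_def by blast
  interpret almost_surely_killed_process P \<kappa>
    by (intro almost_surely_killed_process.intro killed_process.intro
        almost_surely_killed_process_axioms.intro law assms)
  have P: "P \<in> completion \<mu> \<rightarrow>\<^sub>M subprob_algebra path_space"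
    by (rule measurable_subprob_algebra)
       (use law univ assms(6,7) in \<open>auto simp: universally_measurable_def borel_prob_def prob_space_imp_subprob_space\<close>)
  have ne: "space \<mu> \<noteq> {}" by (rule prob_space.not_empty[OF assms(6)])
  define c where "c = resolvent_from \<kappa> P \<mu> (\<lambda>_. 1)"
  let ?\<nu> = "occupation_measure \<mu>"
  have sets_\<nu>: "sets ?\<nu> = sets borel" by (simp add: occupation_measure_def)
  have rate: "(\<integral>\<^sup>+y. ennreal (\<kappa> y) \<partial>?\<nu>) = 1"
    by (rule nn_integral_rate_occupation_measure[OF P assms(6)])
  have "c \<noteq> 0"
  proof
    assume "c = 0"
    then have "emeasure ?\<nu> (space ?\<nu>) = 0"
      using nn_integral_occupation_measure[OF P ne, of "\<lambda>_. 1"] by (simp add: c_def)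
    \<comment> \<open>A null occupation measure would leave no room for the total killing mass one.\<close>
    then have "AE y in ?\<nu>. ennreal (\<kappa> y) = 0"
      by (intro AE_I[where N="space ?\<nu>"]) auto
    then have "(\<integral>\<^sup>+y. ennreal (\<kappa> y) \<partial>?\<nu>) = (\<integral>\<^sup>+y. 0 \<partial>?\<nu>)"
      by (rule nn_integral_cong_AE)
    then show False using rate by simp
  qed
  moreover have "c \<noteq> top" using assms(8) by (simp add: c_def less_top)
  ultimately have c: "inverse c \<noteq> 0" "inverse c \<noteq> top" by simp_all
  have scaled: "(\<integral>\<^sup>+y. f y \<partial>resurrection_invariant \<kappa> P \<mu>) = inverse c * (\<integral>\<^sup>+y. f y \<partial>?\<nu>)"
    if "f \<in> borel_measurable borel" for f
    unfolding resurrection_invariant_eq[OF P ne] c_def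
    by (rule nn_integral_scale_measure) (use that sets_\<nu> in \<open>simp cong: measurable_cong_sets\<close>)
  have "(\<integral>\<^sup>+x\<in>A. ennreal (\<kappa> x) \<partial>resurrection_invariant \<kappa> P \<mu>) /
      (\<integral>\<^sup>+x. ennreal (\<kappa> x) \<partial>resurrection_invariant \<kappa> P \<mu>) =
    inverse c * (\<integral>\<^sup>+y\<in>A. ennreal (\<kappa> y) \<partial>?\<nu>) / inverse c"
    using assms(9) by (subst (1 2) scaled) (simp_all add: rate)
  also have "\<dots> = (\<integral>\<^sup>+y\<in>A. ennreal (\<kappa> y) \<partial>?\<nu>)"
    using c by (simp add: mult.commute[of "inverse c"] ennreal_mult_divide_eq)
  finally show ?thesis
    using emeasure_killed_law_from[OF P ne assms(9)] by simp
qed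

end
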